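(* For every integer $n\ge 2$ we have $$r_n(\beta)\le 1-\frac{3}{10}(1-\beta)+\mathcal O\big((1-\beta)^2\big).$$
   Context: $\beta$ denotes a real number with $0\le\beta\le 1$. For an integer $n\ge2$, $S(n,\beta)$ is the set of complex polynomials of degree $n$ with all roots in the closed unit disk and at least one root at $\beta$. For a polynomial $P$, $|P|_\beta$ is the distance between $\beta$ and the closest root of the derivative $P'$. Define $r_n(\beta)=\sup\{|P|_\beta: P\in S(n,\beta)\}$. The inequality $A\le B+\mathcal O((1-\beta)^s)$ means that there are constants $C$ and $\beta_0<1$, depending only on $n$, such that $A\le B+C(1-\beta)^s$ for all $\beta\in(\beta_0,1)$. *)

theory Defs
  imports "HOL-Analysis.Analysis" "HOL-Computational_Algebra.Polynomial"
begin

definition S_set :: "nat \<Rightarrow> real \<Rightarrow> complex poly set" where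
  "S_set n \<beta> = {P. degree P = n \<and> (\<forall>z. poly P z = 0 \<longrightarrow> norm z \<le> 1) \<and> poly P (of_real \<beta>) = 0}"

(* The Min ranges over a finite nonempty set whenever degree P \<ge> 2. *)
definition crit_dist :: "complex poly \<Rightarrow> real \<Rightarrow> real" where
  "crit_dist P \<beta> = Min {dist (of_real \<beta>) \<zeta> | \<zeta>. poly (pderiv P) \<zeta> = 0}"

(* For n \<ge> 2 and 0 \<le> \<beta> \<le> 1 the real-valued supremum is a genuine one: (x - \<beta>)^n lies in
   S_set n \<beta>, and by Gauss-Lucas the roots of the derivative lie in the closed unit disk,
   so the distances are bounded by 2. *)
definition r_sup :: "nat \<Rightarrow> real \<Rightarrow> real" where
  "r_sup n \<beta> = (SUP P \<in> S_set n \<beta>. crit_dist P \<beta>)"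

end

theory Submission
  imports Defs "HOL-Computational_Algebra.Fundamental_Theorem_Algebra"
begin

text \<open>
  Write \<open>\<epsilon> = 1 - \<beta>\<close> and \<open>s = sqrt \<epsilon>\<close>. Let \<open>P\<close> be monic of degree \<open>n\<close> with roots \<open>\<beta>, z\<^sub>k\<close> in the closed unit
  disk and critical points \<open>\<zeta>\<^sub>j\<close>, and suppose that every \<open>\<zeta>\<^sub>j\<close> is at distance at least \<open>\<beta> = 1 - \<epsilon>\<close>
  from \<open>\<beta>\<close>; otherwise the bound is trivial. In degree 2 the critical point is the midpoint of the roots and the bound
  is immediate, so let \<open>n \<ge> 3\<close>. The proof shows that such a \<open>P\<close> is a small perturbation of
  \<open>z^n - 1\<close> and then reads off what the constraints \<open>\<bar>z\<^sub>k\<bar> \<le> 1\<close> say about the perturbation.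

  Localisation. The value \<open>P'(\<beta>)\<close> is both \<open>\<Prod>(\<beta> - z\<^sub>k)\<close> and \<open>n \<Prod>(\<beta> - \<zeta>\<^sub>j)\<close>, so the \<open>z\<^sub>k\<close> stay away from
  \<open>\<beta>\<close>, and then \<open>Re (1/(\<beta> - z\<^sub>k)) \<ge> 1/2 - O(\<epsilon>)\<close>. Since \<open>\<Sum> 1/(\<beta> - \<zeta>\<^sub>j) = P''(\<beta>)/P'(\<beta>) = 2 \<Sum> 1/(\<beta> - z\<^sub>k)\<close>
  while each \<open>\<bar>1/(\<beta> - \<zeta>\<^sub>j)\<bar>\<close> is at most \<open>1 + O(\<epsilon>)\<close>, every \<open>1/(\<beta> - \<zeta>\<^sub>j)\<close> has real part \<open>1 + O(\<epsilon>)\<close>. This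
  gives \<open>Re \<zeta>\<^sub>j = O(s^2)\<close> and \<open>Im \<zeta>\<^sub>j = O(s)\<close> (lemma \<open>critical_point_orders\<close>).

  Expansion. Let \<open>p\<^sub>k\<close> be the coefficients of \<open>P'/n = \<Sum> p\<^sub>k z^(n-1-k)\<close>. Integrating, a root \<open>u\<close> of \<open>P\<close> satisfies
  \<open>u^n = \<beta>^n - \<Sum> n/(n-k) p\<^sub>k (u^(n-k) - \<beta>^(n-k))\<close>. Near each \<open>n\<close>-th root of unity \<open>\<omega>\<close> there is such a \<open>u\<close>, and
  \<open>Re (u^n) \<le> 1\<close> turns into an inequality for the \<open>p\<^sub>k\<close> that is linear up to a quadratic error
  (lemma \<open>root_inequality\<close>). Used with \<open>\<omega>\<close> and its conjugate at order \<open>s^2\<close> it forces \<open>Im p\<^sub>1 = O(s^2)\<close>, hence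
  all \<open>p\<^sub>k\<close> with \<open>k \<ge> 1\<close> are \<open>O(s^2)\<close>; the inequality then holds up to \<open>O(s^4) = O(\<epsilon>^2)\<close>. The \<open>\<zeta>\<^sub>j\<close>
  are imaginary to leading order, so \<open>i^k p\<^sub>k\<close> is real to leading order, and averaging over \<open>\<omega>\<close> and its conjugate
  removes the terms of order \<open>s^3\<close>; only \<open>Re p\<^sub>1\<close> and \<open>Re p\<^sub>2\<close> remain. That is why the error is of order
  \<open>\<epsilon>^2\<close> and not merely \<open>\<epsilon>^(3/2)\<close>.

  Optimisation. With \<open>V = \<Sum> (Im \<zeta>\<^sub>j)^2 \<ge> 0\<close>, \<open>D = \<Sum> (1 - \<bar>\<beta> - \<zeta>\<^sub>j\<bar>^2)\<close> and \<open>c = Re \<omega> < 1\<close>, what remains is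
  \<open>\<epsilon> - D/(2(n-1)) \<le> \<epsilon>/(1-c) + V (1/(2(n-1)) - (1+c)/(n-2)) + O(\<epsilon>^2)\<close> (lemma \<open>defect_inequality\<close>).
  A convex combination of two of these inequalities, for \<open>c\<close> on either side of \<open>-n/(2(n-1))\<close>, cancels \<open>V\<close>
  (for \<open>n = 3\<close> a single one has a nonpositive coefficient at \<open>V\<close>), and the combination of the values \<open>1/(1-c)\<close> is at most \<open>7/10\<close>. So \<open>D \<ge> 2(n-1)(3\<epsilon>/10 - O(\<epsilon>^2))\<close>, and some
  \<open>\<zeta>\<^sub>j\<close> is within \<open>1 - 3\<epsilon>/10 + O(\<epsilon>^2)\<close> of \<open>\<beta>\<close>. For \<open>n = 5\<close> the combination equals \<open>7/10\<close>
  exactly, so this degree leaves no slack in the linear term.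

  All constants have to depend on \<open>n\<close> only. The order estimates are therefore taken along a filter on the set of all
  admissible triples \<open>(\<beta>, z, \<zeta>)\<close>, under which \<open>\<beta>\<close> tends to 1.
\<close>

section \<open>Polynomials given by their roots\<close>

definition root_poly :: "nat \<Rightarrow> (nat \<Rightarrow> complex) \<Rightarrow> complex poly" where
  "root_poly m \<zeta> = (\<Prod>j<m. [:- \<zeta> j, 1:])"

text \<open>\<open>rcoeff m \<zeta> k\<close> is the \<open>k\<close>-th elementary symmetric function of the \<open>\<zeta>\<^sub>j\<close> with sign \<open>(-1)^k\<close>. Taking it from the
  reversed product keeps the index \<open>k\<close> equal to the degree of homogeneity in the \<open>\<zeta>\<^sub>j\<close>, which is what the
  order estimates are about, and gives a recursion in \<open>m\<close>.\<close>

definition rcoeff :: "nat \<Rightarrow> (nat \<Rightarrow> complex) \<Rightarrow> nat \<Rightarrow> complex" where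
  "rcoeff m \<zeta> k = coeff (\<Prod>j<m. [:1, - \<zeta> j:]) k"

lemma degree_root_poly: "degree (root_poly m \<zeta>) = m"
  by (simp add: root_poly_def degree_prod_sum_eq)

lemma lead_coeff_root_poly: "lead_coeff (root_poly m \<zeta>) = 1"
  by (simp add: root_poly_def lead_coeff_prod)

lemma poly_root_poly: "poly (root_poly m \<zeta>) w = (\<Prod>j<m. w - \<zeta> j)"
  by (simp add: root_poly_def poly_prod)

lemma coeff_root_poly:
  assumes "k \<le> m"
  shows "coeff (root_poly m \<zeta>) (m - k) = rcoeff m \<zeta> k"
proof -
  have r: "reflect_poly [:- \<zeta> j, 1:] = [:1, - \<zeta> j:]" for j
    by (cases "\<zeta> j = 0") (auto simp: reflect_poly_def cCons_def)
  have "(\<Prod>j<m. [:1, - \<zeta> j:]) = reflect_poly (root_poly m \<zeta>)"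
    by (simp add: root_poly_def reflect_poly_prod r)
  then show ?thesis
    using assms by (simp add: rcoeff_def coeff_reflect_poly degree_root_poly)
qed

lemma rcoeff_empty: "rcoeff 0 \<zeta> k = (if k = 0 then 1 else 0)"
  by (simp add: rcoeff_def coeff_1)

lemma rcoeff_zero: "rcoeff m \<zeta> 0 = 1"
  by (induction m) (simp_all add: rcoeff_def mult.commute)

lemma rcoeff_Suc: "rcoeff (Suc m) \<zeta> (Suc k) = rcoeff m \<zeta> (Suc k) - \<zeta> m * rcoeff m \<zeta> k"
  by (simp add: rcoeff_def mult.commute)

lemma rcoeff_one: "rcoeff m \<zeta> (Suc 0) = - (\<Sum>j<m. \<zeta> j)"
  by (induction m) (simp_all add: rcoeff_empty rcoeff_Suc rcoeff_zero)

text \<open>Newton's identity for the second elementary symmetric function. It is needed because the second power sum, not the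
  symmetric function itself, carries the sum of the \<open>(Im \<zeta>\<^sub>j)^2\<close>.\<close>

lemma rcoeff_two: "2 * rcoeff m \<zeta> (Suc (Suc 0)) = (\<Sum>j<m. \<zeta> j)^2 - (\<Sum>j<m. (\<zeta> j)^2)"
proof (induction m)
  case (Suc m)
  then show ?case
    by (simp add: rcoeff_Suc rcoeff_one algebra_simps power2_eq_square)
qed (simp add: rcoeff_empty)

text \<open>Integrating the expansion of the derivative. The constant of integration drops out of a difference of two values.\<close>

lemma poly_difference_rcoeff:
  assumes "degree P = n" and "pderiv P = smult (of_nat n) (root_poly (n - 1) \<zeta>)"
  shows "poly P u - poly P v =
    (\<Sum>k<n. of_nat n / of_nat (n - k) * rcoeff (n - 1) \<zeta> k * (u ^ (n - k) - v ^ (n - k)))"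
proof -
  have c: "coeff P (n - k) = of_nat n / of_nat (n - k) * rcoeff (n - 1) \<zeta> k" if "k < n" for k
  proof -
    have "of_nat (n - k) * coeff P (n - k) = coeff (pderiv P) (n - 1 - k)"
      using that by (simp add: coeff_pderiv Suc_diff_Suc)
    also have "\<dots> = of_nat n * rcoeff (n - 1) \<zeta> k"
      using that coeff_root_poly[of k "n - 1" \<zeta>] by (simp add: assms(2))
    finally show ?thesis using that by (simp add: field_simps)
  qed
  have "poly P u - poly P v = (\<Sum>i\<le>n. coeff P i * (u ^ i - v ^ i))"
    by (simp add: poly_altdef assms(1) sum_subtractf algebra_simps)
  also have "\<dots> = (\<Sum>i\<in>{1..n}. coeff P i * (u ^ i - v ^ i))"
    by (rule sum.mono_neutral_right) (auto simp: Suc_le_eq)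
  also have "\<dots> = (\<Sum>k<n. coeff P (n - k) * (u ^ (n - k) - v ^ (n - k)))"
    by (rule sum.reindex_bij_witness[where i = "\<lambda>k. n - k" and j = "\<lambda>i. n - i"]) auto
  also have "\<dots> = (\<Sum>k<n. of_nat n / of_nat (n - k) * rcoeff (n - 1) \<zeta> k * (u ^ (n - k) - v ^ (n - k)))"
    by (rule sum.cong) (simp_all add: c)
  finally show ?thesis .
qed

lemma pderiv_linear_mult_at_root:
  fixes Q :: "complex poly"
  shows "poly (pderiv ([:- b, 1:] * Q)) b = poly Q b"
    and "poly (pderiv (pderiv ([:- b, 1:] * Q))) b = 2 * poly (pderiv Q) b"
  by (simp_all add: pderiv_mult pderiv_pCons pderiv_add del: mult_pCons_left)

lemma root_poly_log_derivative:
  assumes "\<And>j. j < m \<Longrightarrow> b \<noteq> \<zeta> j"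
  shows "poly (pderiv (root_poly m \<zeta>)) b = poly (root_poly m \<zeta>) b * (\<Sum>j<m. 1 / (b - \<zeta> j))"
proof -
  have "(\<Prod>i\<in>{..<m} - {j}. b - \<zeta> i) = (\<Prod>i<m. b - \<zeta> i) * (1 / (b - \<zeta> j))" if "j < m" for j
  proof -
    have "(\<Prod>i<m. b - \<zeta> i) = (b - \<zeta> j) * (\<Prod>i\<in>{..<m} - {j}. b - \<zeta> i)"
      using that by (subst prod.remove[of _ j]) auto
    then show ?thesis using assms[OF that] by simp
  qed
  then show ?thesis
    by (simp add: poly_root_poly)
       (simp add: root_poly_def pderiv_prod poly_sum poly_prod pderiv_pCons sum_distrib_left)
qed

section \<open>Roots and critical points of a polynomial with root beta\<close>

text \<open>The factor \<open>root_poly (n - 1) z\<close> collects the roots other than \<open>\<beta>\<close>, and \<open>\<zeta>\<close> lists the critical points with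
  multiplicity. Indexed families make both available as functions of a point of a filter later on.\<close>

definition config :: "nat \<Rightarrow> real \<Rightarrow> (nat \<Rightarrow> complex) \<Rightarrow> (nat \<Rightarrow> complex) \<Rightarrow> bool" where
  "config n \<beta> z \<zeta> \<longleftrightarrow> (\<forall>k<n-1. norm (z k) \<le> 1) \<and>
     pderiv ([:- of_real \<beta>, 1:] * root_poly (n - 1) z) = smult (of_nat n) (root_poly (n - 1) \<zeta>)"

text \<open>Both sides are the value of the derivative at \<open>\<beta>\<close>.\<close>

lemma config_prod:
  assumes "config n \<beta> z \<zeta>"
  shows "(\<Prod>k<n-1. of_real \<beta> - z k) = of_nat n * (\<Prod>j<n-1. of_real \<beta> - \<zeta> j)"
proof -
  have "poly (root_poly (n - 1) z) (of_real \<beta>) = poly (smult (of_nat n) (root_poly (n - 1) \<zeta>)) (of_real \<beta>)"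
    using assms pderiv_linear_mult_at_root(1)[of "of_real \<beta>" "root_poly (n - 1) z"]
    by (simp add: config_def)
  then show ?thesis by (simp add: poly_root_poly)
qed

text \<open>Both sides are the quotient of the second and the first derivative at \<open>\<beta>\<close>.\<close>

lemma config_sum_inverse:
  assumes "config n \<beta> z \<zeta>" "n \<ge> 1" and "\<And>j. j < n - 1 \<Longrightarrow> of_real \<beta> \<noteq> \<zeta> j"
  shows "(\<Sum>j<n-1. 1 / (of_real \<beta> - \<zeta> j)) = 2 * (\<Sum>k<n-1. 1 / (of_real \<beta> - z k))"
proof -
  let ?b = "of_real \<beta> :: complex"
  let ?Z = "root_poly (n - 1) z" and ?D = "root_poly (n - 1) \<zeta>"
  have z: "?b \<noteq> z k" if "k < n - 1" for k
  proof -
    have "(\<Prod>k<n-1. ?b - z k) \<noteq> 0"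
      unfolding config_prod[OF assms(1)] using assms(2,3) by (auto simp: prod_zero_iff)
    then show ?thesis using that by auto
  qed
  have d: "pderiv ([:- ?b, 1:] * ?Z) = smult (of_nat n) ?D"
    using assms(1) by (simp add: config_def)
  have v: "poly ?Z ?b = of_nat n * poly ?D ?b"
    using config_prod[OF assms(1)] by (simp add: poly_root_poly)
  have nz: "poly ?Z ?b \<noteq> 0" using z by (auto simp: poly_root_poly prod_zero_iff)
  have "2 * poly (pderiv ?Z) ?b = of_nat n * poly (pderiv ?D) ?b"
    using pderiv_linear_mult_at_root(2)[of ?b ?Z] unfolding d by (simp add: pderiv_smult)
  then have "poly ?Z ?b * (2 * (\<Sum>k<n-1. 1 / (?b - z k))) = poly ?Z ?b * (\<Sum>j<n-1. 1 / (?b - \<zeta> j))"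
    using assms(3) z v by (simp add: root_poly_log_derivative)
  with nz show ?thesis by simp
qed

text \<open>The product of the \<open>\<bar>\<beta> - z\<^sub>k\<bar>\<close> is at least \<open>n 2^(-(n-1))\<close> by the previous product formula, and each factor is at
  most 2, so no single factor can be small.\<close>

lemma config_separation:
  assumes "config n \<beta> z \<zeta>" "n \<ge> 1" "1 / 2 \<le> \<beta>" "\<beta> \<le> 1"
    and far: "\<And>j. j < n - 1 \<Longrightarrow> \<beta> \<le> norm (of_real \<beta> - \<zeta> j)"
    and k: "k < n - 1"
  shows "(1 / 4) ^ n \<le> norm (of_real \<beta> - z k)"
proof -
  let ?b = "of_real \<beta> :: complex"
  have "(1 / 2) ^ (n - 1) \<le> (\<Prod>j<n-1. norm (?b - \<zeta> j))"
    using prod_mono[of "{..<n-1}" "\<lambda>_. 1/2" "\<lambda>j. norm (?b - \<zeta> j)"] far assms(3) by force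
  also have "\<dots> \<le> real n * (\<Prod>j<n-1. norm (?b - \<zeta> j))"
    using assms(2) mult_right_mono[of 1 "real n" "\<Prod>j<n-1. norm (?b - \<zeta> j)"] by (simp add: prod_nonneg)
  also have "\<dots> = norm (\<Prod>k<n-1. ?b - z k)"
    using config_prod[OF assms(1)] by (simp only: norm_mult prod_norm norm_of_nat)
  also have "\<dots> = norm (?b - z k) * (\<Prod>i\<in>{..<n-1} - {k}. norm (?b - z i))"
    using k by (subst prod_norm[symmetric], intro prod.remove) auto
  also have "\<dots> \<le> norm (?b - z k) * 2 ^ (n - 2)"
  proof -
    have "norm (?b - z i) \<le> 2" if "i < n - 1" for i
    proof -
      have "norm (z i) \<le> 1" using assms(1) that by (simp add: config_def)
      then show ?thesis using norm_triangle_ineq4[of ?b "z i"] assms(3,4) by simp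
    qed
    then have "(\<Prod>i\<in>{..<n-1} - {k}. norm (?b - z i)) \<le> (\<Prod>i\<in>{..<n-1} - {k}. 2)"
      by (intro prod_mono) auto
    also have "\<dots> = 2 ^ (n - 2)" using k by simp
    finally show ?thesis by (intro mult_left_mono) auto
  qed
  finally have *: "(1 / 2) ^ (n - 1) \<le> norm (?b - z k) * 2 ^ (n - 2)" .
  \<comment> \<open>Powers are rounded up to \<open>n\<close>, which avoids the truncated exponent \<open>n - 2\<close> in the statement.\<close>
  have "(1 / 4 :: real) ^ n = (1/2) ^ n * (1/2) ^ n"
    by (simp add: power_mult_distrib[symmetric])
  also have "\<dots> \<le> (1/2) ^ (n - 1) * (1/2) ^ (n - 2)"
    by (intro mult_mono power_decreasing) auto
  also have "\<dots> \<le> norm (?b - z k) * 2 ^ (n - 2) * (1/2) ^ (n - 2)"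
    using * by (intro mult_right_mono) auto
  also have "\<dots> = norm (?b - z k)"
    by (simp add: mult.assoc power_mult_distrib[symmetric])
  finally show ?thesis .
qed

text \<open>On the unit disk \<open>Re (1/(1 - z)) \<ge> 1/2\<close>. For \<open>\<beta>\<close> inside the circle the real part is
  unbounded below as \<open>z\<close> approaches \<open>\<beta>\<close>, but at distance \<open>c\<close> from \<open>\<beta>\<close> the loss is linear in \<open>1 - \<beta>\<close>.\<close>

lemma Re_inverse_chord:
  assumes "norm z \<le> 1" "1 / 2 \<le> \<beta>" "\<beta> \<le> 1" "0 < c" "c \<le> norm (of_real \<beta> - z)"
  shows "1 / 2 - 2 / c\<^sup>2 * (1 - \<beta>) \<le> Re (1 / (of_real \<beta> - z))"
proof -
  define w where "w = of_real \<beta> - z"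
  have cw: "c \<le> norm w" using assms by (simp add: w_def)
  then have c2: "c\<^sup>2 \<le> (norm w)\<^sup>2" using assms(4) by (intro power_mono) auto
  have w0: "0 < (norm w)\<^sup>2" using cw assms(4) by auto
  have "(norm z)\<^sup>2 \<le> 1" using assms(1) by (simp add: power_le_one)
  moreover have "(norm z)\<^sup>2 = \<beta>\<^sup>2 - 2 * \<beta> * Re w + (norm w)\<^sup>2"
    unfolding cmod_power2 w_def by (simp add: algebra_simps power2_eq_square)
  ultimately have 1: "(norm w)\<^sup>2 - (1 - \<beta>\<^sup>2) \<le> 2 * \<beta> * Re w" by simp
  have 2: "1 - \<beta>\<^sup>2 \<le> 2 * (1 - \<beta>)" using zero_le_power2[of "1 - \<beta>"] by (simp add: power2_eq_square algebra_simps)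
  have Re: "Re (1 / w) = Re w / (norm w)\<^sup>2" by (simp add: Re_divide cmod_power2)
  have "1 - 2 * (1 - \<beta>) / c\<^sup>2 \<le> 1 - 2 * (1 - \<beta>) / (norm w)\<^sup>2"
    using c2 assms(3,4) by (intro diff_mono divide_left_mono order.refl mult_pos_pos w0) auto
  also have "\<dots> \<le> 2 * \<beta> * Re w / (norm w)\<^sup>2"
  proof -
    have "((norm w)\<^sup>2 - 2 * (1 - \<beta>)) / (norm w)\<^sup>2 \<le> 2 * \<beta> * Re w / (norm w)\<^sup>2"
      using 1 2 w0 by (intro divide_right_mono) auto
    then show ?thesis using w0 by (simp add: diff_divide_distrib)
  qed
  also have "\<dots> = 2 * \<beta> * Re (1 / w)" by (simp add: Re)
  finally have 3: "1 - 2 * (1 - \<beta>) / c\<^sup>2 \<le> 2 * \<beta> * Re (1 / w)" .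
  show ?thesis
  proof (cases "1 - 2 * (1 - \<beta>) / c\<^sup>2 \<le> 0")
    case True
    show ?thesis
    proof (cases "Re (1/w) \<ge> 0")
      case True' : True
      have "1 / 2 - 2 / c\<^sup>2 * (1 - \<beta>) \<le> 0"
        using True assms(3,4) by (simp add: field_simps)
      with True' show ?thesis unfolding w_def[symmetric] by linarith
    next
      case False
      then have "2 * \<beta> * Re (1/w) \<le> 1 * Re (1/w)"
        using assms(2) by (intro mult_right_mono_neg) auto
      then have "1 - 2 * (1 - \<beta>) / c\<^sup>2 \<le> Re (1/w)" using 3 by linarith
      then show ?thesis unfolding w_def[symmetric] by simp
    qed
  next
    case False
    then have "0 < 2 * \<beta> * Re (1/w)" using 3 by linarith
    then have "0 < Re (1/w)" using assms(2) by (simp add: zero_less_mult_iff)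
    then have "2 * \<beta> * Re (1/w) \<le> 2 * Re (1/w)"
      using assms(3) by simp
    then have "1 / 2 - (1 - \<beta>) / c\<^sup>2 \<le> Re (1/w)" using 3 by linarith
    moreover have "0 \<le> (1 - \<beta>) / c\<^sup>2" using assms(3) by simp
    moreover have "2 / c\<^sup>2 * (1 - \<beta>) = 2 * ((1 - \<beta>) / c\<^sup>2)" by simp
    ultimately show ?thesis unfolding w_def[symmetric] by linarith
  qed
qed

text \<open>The sum of the real parts is at least \<open>n - 1 - O(1 - \<beta>)\<close> and none of them exceeds \<open>1/\<beta>\<close>, so each of them is close
  to 1.\<close>

lemma config_Re_inverse:
  assumes "config n \<beta> z \<zeta>" "n \<ge> 1" "1 / 2 \<le> \<beta>" "\<beta> \<le> 1"
    and far: "\<And>j. j < n - 1 \<Longrightarrow> \<beta> \<le> norm (of_real \<beta> - \<zeta> j)"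
    and j: "j < n - 1"
  shows "1 - 4 * real n * 16 ^ n * (1 - \<beta>) - 2 * real n * (1 - \<beta>) \<le> Re (1 / (of_real \<beta> - \<zeta> j))"
proof -
  let ?b = "of_real \<beta> :: complex" and ?e = "1 - \<beta>" and ?m = "real (n - 1)"
  have "Re (1 / (?b - \<zeta> i)) \<le> 1 + 2 * ?e" if "i < n - 1" for i
  proof -
    have "Re (1 / (?b - \<zeta> i)) \<le> norm (1 / (?b - \<zeta> i))" by (rule complex_Re_le_cmod)
    also have "\<dots> = 1 / norm (?b - \<zeta> i)" by (simp add: norm_divide)
    also have "\<dots> \<le> 1 / \<beta>" using far[OF that] assms(3) by (intro divide_left_mono mult_pos_pos) auto
    also have "\<dots> \<le> 1 + 2 * ?e"
    proof -
      have "0 \<le> (2 * \<beta> - 1) * ?e" using assms(3,4) by simp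
      then show ?thesis using assms(3) by (simp add: field_simps)
    qed
    finally show ?thesis .
  qed
  then have "(\<Sum>i\<in>{..<n-1} - {j}. Re (1 / (?b - \<zeta> i))) \<le> (\<Sum>i\<in>{..<n-1} - {j}. 1 + 2 * ?e)"
    by (intro sum_mono) auto
  also have "\<dots> = (?m - 1) * (1 + 2 * ?e)" using j by (simp add: of_nat_diff)
  finally have up: "(\<Sum>i\<in>{..<n-1} - {j}. Re (1 / (?b - \<zeta> i))) \<le> (?m - 1) * (1 + 2 * ?e)" .
  have "1/2 - 2 * 16 ^ n * ?e \<le> Re (1 / (?b - z k))" if "k < n - 1" for k
  proof -
    have "1/2 - 2 / ((1/4)^n)\<^sup>2 * ?e \<le> Re (1 / (?b - z k))"
      using config_separation[OF assms(1-4) far that] assms(1) that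
      by (intro Re_inverse_chord assms) (auto simp: config_def)
    moreover have "((1/4 :: real)^n)\<^sup>2 = 1 / 16 ^ n"
      by (simp add: power_mult[symmetric] mult.commute[of n 2] power_mult power_divide)
    ultimately show ?thesis by simp
  qed
  then have "(\<Sum>k<n-1. 1/2 - 2 * 16 ^ n * ?e) \<le> (\<Sum>k<n-1. Re (1 / (?b - z k)))"
    by (intro sum_mono) auto
  then have "?m * (1 - 4 * 16 ^ n * ?e) \<le> 2 * (\<Sum>k<n-1. Re (1 / (?b - z k)))"
    by (simp add: algebra_simps)
  also have "\<dots> = Re (2 * (\<Sum>k<n-1. 1 / (?b - z k)))" by simp
  also have "\<dots> = (\<Sum>i<n-1. Re (1 / (?b - \<zeta> i)))"
  proof -
    have "?b \<noteq> \<zeta> i" if "i < n - 1" for i using far[OF that] assms(3) by auto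
    from config_sum_inverse[OF assms(1,2) this] show ?thesis by (metis Re_sum)
  qed
  also have "\<dots> = Re (1 / (?b - \<zeta> j)) + (\<Sum>i\<in>{..<n-1} - {j}. Re (1 / (?b - \<zeta> i)))"
    using j by (intro sum.remove) auto
  finally have "?m * (1 - 4 * 16 ^ n * ?e) - (?m - 1) * (1 + 2 * ?e) \<le> Re (1 / (?b - \<zeta> j))"
    using up by linarith
  moreover have "?m * (1 - 4 * 16 ^ n * ?e) - (?m - 1) * (1 + 2 * ?e)
      = 1 - 4 * ?m * 16 ^ n * ?e - 2 * (?m - 1) * ?e"
    by (simp add: algebra_simps)
  moreover have "4 * ?m * 16 ^ n * ?e \<le> 4 * real n * 16 ^ n * ?e"
    using assms(4) by (intro mult_right_mono) auto
  moreover have "2 * (?m - 1) * ?e \<le> 2 * real n * ?e"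
    using assms(4) by (intro mult_right_mono) auto
  ultimately show ?thesis by linarith
qed

text \<open>A point outside the disk of radius \<open>1 - e\<close> whose inverse has real part at least \<open>1 - L e\<close> lies in the thin region
  between two almost tangent circles at 1: its real part is 1 up to \<open>O(e)\<close>, its imaginary part only \<open>O(sqrt e)\<close>.\<close>

lemma near_one_of_Re_inverse:
  fixes w :: complex
  assumes "0 \<le> e" "e \<le> 1 / 2" "0 \<le> L" "L * e \<le> 1 / 2"
    and "1 - e \<le> norm w" "1 - L * e \<le> Re (1 / w)"
  shows "\<bar>Re w - 1\<bar> \<le> (2 + 4 * L) * e" "(Im w)\<^sup>2 \<le> (4 + 20 * L) * e"
proof -
  have w0: "0 < norm w" using assms by linarith
  have Re: "Re (1 / w) = Re w / (norm w)\<^sup>2" by (simp add: Re_divide cmod_power2)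
  have 1: "(1 - L * e) * (norm w)\<^sup>2 \<le> Re w"
    using assms(6) w0 unfolding Re by (simp add: field_simps)
  have "(1 - L * e) * (norm w)\<^sup>2 \<le> norm w" using 1 complex_Re_le_cmod[of w] by linarith
  then have 2: "(1 - L * e) * norm w \<le> 1"
    using w0 by (simp add: power2_eq_square)
  have "(1 - L * e) * (1 + 2 * L * e) \<ge> 1"
  proof -
    have "(1 - L * e) * (1 + 2 * L * e) = 1 + (L * e) * (1 - 2 * (L * e))" by (simp add: algebra_simps)
    moreover have "0 \<le> (L * e) * (1 - 2 * (L * e))" using assms by (intro mult_nonneg_nonneg) auto
    ultimately show ?thesis by linarith
  qed
  then have "(1 - L * e) * norm w \<le> (1 - L * e) * (1 + 2 * L * e)" using 2 by linarith
  then have 3: "norm w \<le> 1 + 2 * L * e" using assms(4) by simp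
  have 4: "Re w \<le> 1 + 2 * L * e" using 3 complex_Re_le_cmod[of w] by linarith
  have 5: "1 - 2 * e \<le> (norm w)\<^sup>2"
  proof -
    have "(1 - e)\<^sup>2 \<le> (norm w)\<^sup>2" using assms(1,2,5) by (intro power_mono) auto
    moreover have "1 - 2 * e \<le> (1 - e)\<^sup>2" by (simp add: power2_eq_square algebra_simps)
    ultimately show ?thesis by linarith
  qed
  have "(1 - L * e) * (1 - 2 * e) \<le> (1 - L * e) * (norm w)\<^sup>2"
    using 5 assms(4) by (intro mult_left_mono) auto
  moreover have "1 - L * e - 2 * e \<le> (1 - L * e) * (1 - 2 * e)"
    using assms(1,3) by (simp add: algebra_simps)
  ultimately have 6: "1 - (2 + L) * e \<le> Re w" using 1 by (simp add: algebra_simps)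
  have Le: "0 \<le> L * e" using assms by simp
  show "\<bar>Re w - 1\<bar> \<le> (2 + 4 * L) * e"
    using 4 6 Le assms(1) by (simp add: abs_le_iff algebra_simps)
  have "(norm w)\<^sup>2 \<le> (1 + 2 * L * e)\<^sup>2" using 3 by (intro power_mono) auto
  also have "\<dots> = 1 + 4 * (L * e) + 4 * ((L * e) * (L * e))" by (simp add: power2_eq_square algebra_simps)
  also have "\<dots> \<le> 1 + 4 * (L * e) + 4 * ((L * e) * (1/2))"
    using Le assms(4) by (intro add_left_mono mult_left_mono) auto
  finally have 7: "(norm w)\<^sup>2 \<le> 1 + 6 * (L * e)" by simp
  have 8: "1 - 2 * ((2 + L) * e) \<le> (Re w)\<^sup>2"
  proof -
    have "0 \<le> (Re w - 1)\<^sup>2" by simp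
    then have "2 * Re w - 1 \<le> (Re w)\<^sup>2" by (simp add: power2_eq_square algebra_simps)
    then show ?thesis using 6 by linarith
  qed
  have "(Im w)\<^sup>2 = (norm w)\<^sup>2 - (Re w)\<^sup>2" by (simp add: cmod_power2)
  also have "\<dots> \<le> 6 * (L * e) + 2 * ((2 + L) * e)" using 7 8 by linarith
  also have "\<dots> \<le> (4 + 20 * L) * e" using Le by (simp add: algebra_simps)
  finally show "(Im w)\<^sup>2 \<le> (4 + 20 * L) * e" .
qed

lemma config_expansion:
  assumes "config n \<beta> z \<zeta>" "n \<ge> 1"
  shows "(u - of_real \<beta>) * (\<Prod>k<n-1. u - z k) =
    (\<Sum>k<n. of_nat n / of_nat (n - k) * rcoeff (n - 1) \<zeta> k * (u ^ (n - k) - of_real \<beta> ^ (n - k)))"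
proof -
  let ?P = "[:- of_real \<beta>, 1:] * root_poly (n - 1) z"
  have "root_poly (n - 1) z \<noteq> 0" using lead_coeff_root_poly[of "n - 1" z] by auto
  then have "degree ?P = n"
    using assms(2) by (subst degree_mult_eq) (auto simp: degree_root_poly)
  moreover have "pderiv ?P = smult (of_nat n) (root_poly (n - 1) \<zeta>)"
    using assms(1) by (simp only: config_def)
  ultimately show ?thesis
    using poly_difference_rcoeff[of ?P n \<zeta> u "of_real \<beta>"]
    by (simp add: poly_root_poly algebra_simps)
qed

text \<open>The distances from \<open>w\<close> to the roots multiply to the value of the polynomial, so the closest root is at distance at
  most the \<open>n\<close>-th root of that value.\<close>

lemma config_root_close:
  assumes "config n \<beta> z \<zeta>" "n \<ge> 1" "0 \<le> \<beta>" "\<beta> \<le> 1"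
  shows "\<exists>u. norm u \<le> 1 \<and> (u - of_real \<beta>) * (\<Prod>k<n-1. u - z k) = 0 \<and>
    norm (w - u) ^ n \<le> norm ((w - of_real \<beta>) * (\<Prod>k<n-1. w - z k))"
proof -
  define Z where "Z = insert (of_real \<beta>) (z ` {..<n-1})"
  have Z: "finite Z" "Z \<noteq> {}" by (auto simp: Z_def)
  obtain u where u: "u \<in> Z" "\<And>v. v \<in> Z \<Longrightarrow> norm (w - u) \<le> norm (w - v)"
  proof -
    have "Min ((\<lambda>v. norm (w - v)) ` Z) \<in> (\<lambda>v. norm (w - v)) ` Z"
      using Z by (intro Min_in) auto
    then obtain u where "u \<in> Z" "norm (w - u) = Min ((\<lambda>v. norm (w - v)) ` Z)" by auto
    then show ?thesis using Z by (intro that[of u]) auto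
  qed
  have "norm (w - u) ^ n = norm (w - u) * (\<Prod>k<n-1. norm (w - u))"
    using assms(2) by (simp add: power_Suc[symmetric] del: power_Suc)
  also have "\<dots> \<le> norm (w - of_real \<beta>) * (\<Prod>k<n-1. norm (w - z k))"
    by (intro mult_mono prod_mono u prod_nonneg conjI) (auto simp: Z_def)
  also have "\<dots> = norm ((w - of_real \<beta>) * (\<Prod>k<n-1. w - z k))"
    by (simp only: norm_mult prod_norm)
  finally have "norm (w - u) ^ n \<le> norm ((w - of_real \<beta>) * (\<Prod>k<n-1. w - z k))" .
  moreover have "norm u \<le> 1" using u(1) assms by (auto simp: Z_def config_def)
  moreover have "(u - of_real \<beta>) * (\<Prod>k<n-1. u - z k) = 0"
    using u(1) by (auto simp: Z_def)
  ultimately show ?thesis by blast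
qed

section \<open>Orders of vanishing along a filter\<close>

locale vanishing_scale =
  fixes F :: "'x filter" and s :: "'x \<Rightarrow> real"
  assumes s_tendsto: "(s \<longlongrightarrow> 0) F"
    and s_nonneg: "\<forall>\<^sub>F x in F. 0 \<le> s x"
begin

text \<open>This is \<open>f = O(s^k)\<close> along \<open>F\<close>, for values in any normed space, so that complex quantities are measured against the
  real scale \<open>s\<close>. Only integral powers of \<open>s\<close> occur, which makes orders additive under multiplication.\<close>

definition of_order :: "nat \<Rightarrow> ('x \<Rightarrow> 'b::real_normed_vector) \<Rightarrow> bool" where
  "of_order k f \<longleftrightarrow> (\<exists>K. \<forall>\<^sub>F x in F. norm (f x) \<le> K * s x ^ k)"

lemma of_orderI: "\<forall>\<^sub>F x in F. norm (f x) \<le> K * s x ^ k \<Longrightarrow> of_order k f"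
  by (auto simp: of_order_def)

lemma of_orderE:
  assumes "of_order k f"
  obtains K where "0 \<le> K" "\<forall>\<^sub>F x in F. norm (f x) \<le> K * s x ^ k"
proof -
  obtain K where K: "\<forall>\<^sub>F x in F. norm (f x) \<le> K * s x ^ k"
    using assms by (auto simp: of_order_def)
  have "\<forall>\<^sub>F x in F. norm (f x) \<le> max K 0 * s x ^ k"
    using K s_nonneg
  proof eventually_elim
    case (elim x)
    have "K * s x ^ k \<le> max K 0 * s x ^ k" using elim by (intro mult_right_mono) auto
    with elim show ?case by linarith
  qed
  then show ?thesis by (intro that[of "max K 0"]) auto
qed

lemma s_le_one: "\<forall>\<^sub>F x in F. s x \<le> 1"
  using order_tendstoD(2)[OF s_tendsto, of 1] by (auto elim: eventually_mono)

lemma of_order_dominated: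
  assumes "of_order k g" "\<forall>\<^sub>F x in F. norm (f x) \<le> C * norm (g x)" "0 \<le> C"
  shows "of_order k f"
proof -
  obtain K where "\<forall>\<^sub>F x in F. norm (g x) \<le> K * s x ^ k" using assms(1) by (auto simp: of_order_def)
  then have "\<forall>\<^sub>F x in F. norm (f x) \<le> C * K * s x ^ k"
    using assms(2)
  proof eventually_elim
    case (elim x)
    have "C * norm (g x) \<le> C * (K * s x ^ k)" using elim assms(3) by (intro mult_left_mono) auto
    with elim show ?case by (simp add: mult.assoc)
  qed
  then show ?thesis by (rule of_orderI)
qed

lemma of_order_cong:
  assumes "of_order k g" "\<forall>\<^sub>F x in F. f x = g x"
  shows "of_order k f"
  by (rule of_order_dominated[OF assms(1), of _ 1]) (use assms(2) in \<open>auto elim: eventually_mono\<close>)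

lemma of_order_weaken:
  assumes "of_order k f" "i \<le> k"
  shows "of_order i f"
proof -
  obtain K where "0 \<le> K" and "\<forall>\<^sub>F x in F. norm (f x) \<le> K * s x ^ k" using assms(1) by (rule of_orderE)
  from this(2) s_nonneg s_le_one have "\<forall>\<^sub>F x in F. norm (f x) \<le> K * s x ^ i"
  proof eventually_elim
    case (elim x)
    have "K * s x ^ k \<le> K * s x ^ i"
      using elim \<open>0 \<le> K\<close> assms(2) by (intro mult_left_mono power_decreasing) auto
    with elim show ?case by linarith
  qed
  then show ?thesis by (rule of_orderI)
qed

lemma of_order_add:
  assumes "of_order k f" "of_order k g"
  shows "of_order k (\<lambda>x. f x + g x)"
proof -
  obtain K L where "\<forall>\<^sub>F x in F. norm (f x) \<le> K * s x ^ k" "\<forall>\<^sub>F x in F. norm (g x) \<le> L * s x ^ k"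
    using assms by (auto simp: of_order_def)
  then have "\<forall>\<^sub>F x in F. norm (f x + g x) \<le> (K + L) * s x ^ k"
  proof eventually_elim
    case (elim x)
    then show ?case using norm_triangle_ineq[of "f x" "g x"] by (simp add: distrib_right)
  qed
  then show ?thesis by (rule of_orderI)
qed

lemma of_order_minus: "of_order k f \<Longrightarrow> of_order k (\<lambda>x. - f x)"
  by (simp add: of_order_def)

lemma of_order_diff: "of_order k f \<Longrightarrow> of_order k g \<Longrightarrow> of_order k (\<lambda>x. f x - g x)"
  using of_order_add[of k f "\<lambda>x. - g x"] by (simp add: of_order_minus)

lemma of_order_zero: "of_order k (\<lambda>x. 0)"
  by (rule of_orderI[of _ 0]) simp

lemma of_order_sum:
  assumes "\<And>i. i \<in> A \<Longrightarrow> of_order k (f i)"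
  shows "of_order k (\<lambda>x. \<Sum>i\<in>A. f i x)"
  using assms
  by (induction A rule: infinite_finite_induct) (auto simp: of_order_zero of_order_add)

lemma of_order_mult:
  fixes f g :: "'x \<Rightarrow> 'b::real_normed_algebra"
  assumes "of_order k f" "of_order l g" "i \<le> k + l"
  shows "of_order i (\<lambda>x. f x * g x)"
proof -
  obtain K L where "\<forall>\<^sub>F x in F. norm (f x) \<le> K * s x ^ k" "\<forall>\<^sub>F x in F. norm (g x) \<le> L * s x ^ l"
    using assms by (auto simp: of_order_def)
  then have "\<forall>\<^sub>F x in F. norm (f x * g x) \<le> (K * L) * s x ^ (k + l)"
  proof eventually_elim
    case (elim x)
    have "norm (f x * g x) \<le> norm (f x) * norm (g x)" by (rule norm_mult_ineq)
    also have "\<dots> \<le> (K * s x ^ k) * (L * s x ^ l)"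
      using elim order_trans[OF norm_ge_zero elim(1)] by (intro mult_mono) auto
    finally show ?case by (simp add: power_add mult_ac)
  qed
  then show ?thesis using assms(3) by (blast intro: of_orderI of_order_weaken)
qed

lemma of_order_const: "of_order 0 (\<lambda>x. c)"
  by (rule of_orderI[of _ "norm c"]) simp

lemma of_order_cmult:
  fixes f :: "'x \<Rightarrow> 'b::real_normed_algebra"
  shows "of_order k f \<Longrightarrow> of_order k (\<lambda>x. c * f x)"
  by (rule of_order_mult[OF of_order_const, where l = k]) simp_all

lemma of_order_Re: "of_order k f \<Longrightarrow> of_order k (\<lambda>x. Re (f x))"
  by (rule of_order_dominated[of _ f _ 1]) (simp_all add: abs_Re_le_cmod)

lemma of_order_of_real: "of_order k f \<Longrightarrow> of_order k (\<lambda>x. of_real (f x) :: complex)"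
  by (simp add: of_order_def)

lemma of_order_complex:
  assumes "of_order k (\<lambda>x. Re (f x))" "of_order k (\<lambda>x. Im (f x))"
  shows "of_order k f"
proof -
  have "of_order k (\<lambda>x. of_real (Re (f x)) + \<i> * of_real (Im (f x)))"
    by (intro of_order_add of_order_cmult of_order_of_real assms)
  then show ?thesis by (simp add: complex_eq[symmetric])
qed

lemma of_order_scale: "of_order k (\<lambda>x. s x ^ k)"
  by (rule of_orderI[of _ 1]) (use s_nonneg in \<open>auto elim: eventually_mono\<close>)

lemma of_order_tendsto_zero:
  assumes "of_order k f" "0 < k"
  shows "(f \<longlongrightarrow> 0) F"
proof -
  obtain K where K: "\<forall>\<^sub>F x in F. norm (f x) \<le> K * s x ^ k" using assms(1) by (auto simp: of_order_def)
  have "((\<lambda>x. K * s x ^ k) \<longlongrightarrow> K * 0 ^ k) F" by (intro tendsto_intros s_tendsto)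
  then have "((\<lambda>x. K * s x ^ k) \<longlongrightarrow> 0) F" using assms(2) by (simp only: zero_power mult_zero_right)
  with K show ?thesis by (rule Lim_null_comparison)
qed

lemma of_order_power_diff:
  fixes f g :: "'x \<Rightarrow> complex"
  assumes "of_order k (\<lambda>x. f x - g x)" "of_order 0 f" "of_order 0 g"
  shows "of_order k (\<lambda>x. f x ^ i - g x ^ i)"
proof (induction i)
  case (Suc i)
  have g: "of_order 0 (\<lambda>x. g x ^ i)" for i
    by (induction i) (auto intro: of_order_const of_order_mult assms)
  have "of_order k (\<lambda>x. f x * (f x ^ i - g x ^ i) + (f x - g x) * g x ^ i)"
    by (intro of_order_add of_order_mult[OF assms(2) Suc] of_order_mult[OF assms(1) g]) auto
  then show ?case by (simp add: algebra_simps)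
qed (simp add: of_order_zero)

text \<open>The one-sided version \<open>f \<le> O(s^k)\<close>, for the inequalities that come from roots being in the unit disk.\<close>

definition le_order :: "nat \<Rightarrow> ('x \<Rightarrow> real) \<Rightarrow> bool" where
  "le_order k f \<longleftrightarrow> (\<exists>K. \<forall>\<^sub>F x in F. f x \<le> K * s x ^ k)"

lemma le_order_perturb:
  assumes "le_order k f" "of_order k (\<lambda>x. g x - f x)"
  shows "le_order k g"
proof -
  obtain K L where "\<forall>\<^sub>F x in F. f x \<le> K * s x ^ k" "\<forall>\<^sub>F x in F. norm (g x - f x) \<le> L * s x ^ k"
    using assms by (auto simp: le_order_def of_order_def)
  then have "\<forall>\<^sub>F x in F. g x \<le> (K + L) * s x ^ k"
    by eventually_elim (auto simp: distrib_right abs_le_iff)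
  then show ?thesis by (auto simp: le_order_def)
qed

lemma le_order_mono:
  assumes "le_order k f" "\<forall>\<^sub>F x in F. g x \<le> f x"
  shows "le_order k g"
proof -
  obtain K where "\<forall>\<^sub>F x in F. f x \<le> K * s x ^ k" using assms by (auto simp: le_order_def)
  then have "\<forall>\<^sub>F x in F. g x \<le> K * s x ^ k"
    using assms(2) by eventually_elim simp
  then show ?thesis by (auto simp: le_order_def)
qed

lemma le_order_add:
  assumes "le_order k f" "le_order k g"
  shows "le_order k (\<lambda>x. f x + g x)"
proof -
  obtain K L where "\<forall>\<^sub>F x in F. f x \<le> K * s x ^ k" "\<forall>\<^sub>F x in F. g x \<le> L * s x ^ k"
    using assms by (auto simp: le_order_def)
  then have "\<forall>\<^sub>F x in F. f x + g x \<le> (K + L) * s x ^ k"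
    by eventually_elim (auto simp: distrib_right)
  then show ?thesis by (auto simp: le_order_def)
qed

lemma le_order_cmult:
  assumes "le_order k f" "0 \<le> c"
  shows "le_order k (\<lambda>x. c * f x)"
proof -
  obtain K where "\<forall>\<^sub>F x in F. f x \<le> K * s x ^ k" using assms by (auto simp: le_order_def)
  then have "\<forall>\<^sub>F x in F. c * f x \<le> (c * K) * s x ^ k"
    by eventually_elim (use assms(2) in \<open>auto simp: mult.assoc intro: mult_left_mono\<close>)
  then show ?thesis by (auto simp: le_order_def)
qed

lemma of_order_if_le_order:
  assumes "le_order k f" "le_order k (\<lambda>x. - f x)"
  shows "of_order k f"
proof -
  obtain K L where "\<forall>\<^sub>F x in F. f x \<le> K * s x ^ k" "\<forall>\<^sub>F x in F. - f x \<le> L * s x ^ k"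
    using assms by (auto simp: le_order_def)
  then have "\<forall>\<^sub>F x in F. norm (f x) \<le> max K L * s x ^ k"
    using s_nonneg
  proof eventually_elim
    case (elim x)
    have "K * s x ^ k \<le> max K L * s x ^ k" "L * s x ^ k \<le> max K L * s x ^ k"
      using elim by (auto intro!: mult_right_mono)
    with elim show ?case by (simp add: abs_le_iff)
  qed
  then show ?thesis by (rule of_orderI)
qed

text \<open>If the \<open>\<zeta>\<^sub>j\<close> were purely imaginary, \<open>i^k\<close> times their \<open>k\<close>-th symmetric function would be real and of degree \<open>k\<close>.
  Real parts of order 2 disturb this by one further order. The induction adds one \<open>\<zeta>\<^sub>j\<close> at a time; both claims are
  proved together because the second uses the first.\<close>

lemma rcoeff_of_order:
  fixes \<zeta> :: "nat \<Rightarrow> 'x \<Rightarrow> complex"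
  assumes re: "\<And>j. j < m \<Longrightarrow> of_order 2 (\<lambda>x. Re (\<zeta> j x))"
    and im: "\<And>j. j < m \<Longrightarrow> of_order 1 (\<lambda>x. Im (\<zeta> j x))"
  shows "of_order k (\<lambda>x. rcoeff m (\<lambda>j. \<zeta> j x) k)"
    and "of_order (Suc k) (\<lambda>x. Im (\<i> ^ k * rcoeff m (\<lambda>j. \<zeta> j x) k))"
proof -
  have "of_order k (\<lambda>x. rcoeff m (\<lambda>j. \<zeta> j x) k) \<and>
      of_order (Suc k) (\<lambda>x. Im (\<i> ^ k * rcoeff m (\<lambda>j. \<zeta> j x) k))"
    using assms
  proof (induction m arbitrary: k)
    case 0
    then show ?case by (cases k) (auto simp: rcoeff_empty of_order_zero of_order_const)
  next
    case (Suc m)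
    let ?p = "\<lambda>k x. rcoeff m (\<lambda>j. \<zeta> j x) k"
    have IH: "of_order k (?p k)" "of_order (Suc k) (\<lambda>x. Im (\<i> ^ k * ?p k x))" for k
      using Suc by simp_all
    have R: "of_order 2 (\<lambda>x. Re (\<zeta> m x))" and I: "of_order 1 (\<lambda>x. Im (\<zeta> m x))"
      using Suc.prems by simp_all
    have z: "of_order 1 (\<zeta> m)"
      by (intro of_order_complex I of_order_weaken[OF R]) simp
    show ?case
    proof (cases k)
      case 0
      then show ?thesis by (simp add: rcoeff_zero of_order_zero of_order_const)
    next
      case k: (Suc l)
      have 1: "of_order k (\<lambda>x. ?p k x - \<zeta> m x * ?p l x)"
        by (intro of_order_diff IH of_order_mult[OF z IH(1)]) (simp add: k)
      let ?q = "\<lambda>x. \<i> ^ l * ?p l x"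
      have q: "of_order l ?q" by (intro of_order_cmult IH)
      have 2: "of_order (Suc k) (\<lambda>x. Im (\<i> ^ k * ?p k x)
          - (Re (\<zeta> m x) * Re (?q x) - Im (\<zeta> m x) * Im (?q x)))"
        by (intro of_order_diff IH of_order_mult[OF R of_order_Re[OF q]] of_order_mult[OF I IH(2)])
          (simp_all add: k)
      have 3: "\<i> ^ k * (?p k x - \<zeta> m x * ?p l x) = \<i> ^ k * ?p k x - \<i> * (\<zeta> m x * ?q x)" for x
        by (simp add: k algebra_simps)
      have "of_order (Suc k) (\<lambda>x. Im (\<i> ^ k * (?p k x - \<zeta> m x * ?p l x)))"
        unfolding 3 using 2 by simp
      with 1 show ?thesis by (simp add: k rcoeff_Suc)
    qed
  qed
  then show "of_order k (\<lambda>x. rcoeff m (\<lambda>j. \<zeta> j x) k)"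
    and "of_order (Suc k) (\<lambda>x. Im (\<i> ^ k * rcoeff m (\<lambda>j. \<zeta> j x) k))" by auto
qed

text \<open>For \<open>k = 3\<close> the symmetric function itself has order 3 only; its leading part is imaginary.\<close>

lemma Re_rcoeff_of_order:
  fixes \<zeta> :: "nat \<Rightarrow> 'x \<Rightarrow> complex"
  assumes re: "\<And>j. j < m \<Longrightarrow> of_order 2 (\<lambda>x. Re (\<zeta> j x))"
    and im: "\<And>j. j < m \<Longrightarrow> of_order 1 (\<lambda>x. Im (\<zeta> j x))"
    and "3 \<le> k"
  shows "of_order 4 (\<lambda>x. Re (rcoeff m (\<lambda>j. \<zeta> j x) k))"
proof (cases "k = 3")
  case True
  have "of_order 4 (\<lambda>x. - Im (\<i> ^ 3 * rcoeff m (\<lambda>j. \<zeta> j x) 3))"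
    using rcoeff_of_order(2)[where k = 3 and m = m and \<zeta> = \<zeta>, OF re im] by (intro of_order_minus) simp
  then show ?thesis by (simp add: True power3_eq_cube)
next
  case False
  then have "of_order 4 (\<lambda>x. rcoeff m (\<lambda>j. \<zeta> j x) k)"
    using \<open>3 \<le> k\<close> by (intro of_order_weaken[OF rcoeff_of_order(1)[where k = k, OF re im]]) auto
  then show ?thesis by (rule of_order_Re)
qed

end

section \<open>Expansion near the polynomial z^n - 1\<close>

text \<open>The powers \<open>\<omega>^(n-k)\<close> in the expansion turn into conjugates; the substitution of \<open>cnj \<omega>\<close> for \<open>\<omega>\<close> then leaves
  their real parts unchanged.\<close>

lemma root_of_unity_power_diff:
  fixes \<omega> :: complex
  assumes "\<omega> ^ n = 1" "k \<le> n" "0 < n"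
  shows "\<omega> ^ (n - k) = cnj \<omega> ^ k"
proof -
  have "norm \<omega> = 1" using power_eq_1_iff[OF assms(1)] assms(3) by simp
  then have "(\<omega> * cnj \<omega>) ^ k = 1" by (simp add: complex_norm_square[symmetric])
  then have "\<omega> ^ (n - k) * \<omega> ^ k * cnj \<omega> ^ k = \<omega> ^ (n - k)" by (simp add: power_mult_distrib mult.assoc)
  then show ?thesis using assms(1,2) by (simp add: power_add[symmetric])
qed

lemma cis_root_of_unity:
  assumes "0 < n"
  shows "cis (2 * pi * real k / real n) ^ n = 1"
proof -
  have "cis (2 * pi * real k / real n) ^ n = cis (2 * pi * real k)"
    using assms by (simp add: Complex.DeMoivre)
  then show ?thesis by (simp add: cis_multiple_2pi)
qed

text \<open>A family of configurations with \<open>\<beta>\<close> tending to 1 from below, whose critical points keep the distance \<open>\<beta> = 1 - s^2\<close>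
  from \<open>\<beta>\<close>. The index type and the filter are left open; they are chosen at the end so that estimates along the
  filter are uniform in the polynomial.\<close>

locale far_critical_family =
  fixes F :: "'x filter" and n :: nat and \<beta> :: "'x \<Rightarrow> real" and z \<zeta> :: "nat \<Rightarrow> 'x \<Rightarrow> complex"
  assumes n: "3 \<le> n"
    and beta_lim: "filterlim \<beta> (at_left 1) F"
    and conf: "\<forall>\<^sub>F x in F. config n (\<beta> x) (\<lambda>k. z k x) (\<lambda>j. \<zeta> j x)"
    and far: "\<forall>\<^sub>F x in F. \<forall>j<n-1. \<beta> x \<le> norm (of_real (\<beta> x) - \<zeta> j x)"
begin

definition s :: "'x \<Rightarrow> real" where "s x = sqrt (1 - \<beta> x)"

lemma beta_tendsto: "(\<beta> \<longlongrightarrow> 1) F"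
  using beta_lim by (simp add: filterlim_at)

lemma beta_less: "\<forall>\<^sub>F x in F. \<beta> x < 1"
  using beta_lim by (simp add: filterlim_at) (auto elim: eventually_mono)

lemma beta_half: "\<forall>\<^sub>F x in F. 1 / 2 \<le> \<beta> x"
  using order_tendstoD(1)[OF beta_tendsto, of "1/2"] by (auto elim: eventually_mono)

lemma s_square: "\<forall>\<^sub>F x in F. (s x)\<^sup>2 = 1 - \<beta> x"
  using beta_less by eventually_elim (simp add: s_def)

sublocale vanishing_scale F s
proof
  have "((\<lambda>x. sqrt (1 - \<beta> x)) \<longlongrightarrow> sqrt (1 - 1)) F"
    by (intro tendsto_intros beta_tendsto)
  then show "(s \<longlongrightarrow> 0) F" by (simp add: s_def[abs_def])
  show "\<forall>\<^sub>F x in F. 0 \<le> s x"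
    using beta_less by eventually_elim (simp add: s_def)
qed

lemma critical_point_orders:
  assumes j: "j < n - 1"
  shows "of_order 2 (\<lambda>x. Re (\<zeta> j x))" "of_order 1 (\<lambda>x. Im (\<zeta> j x))"
proof -
  define L where "L = 4 * real n * 16 ^ n + 2 * real n"
  have L: "0 \<le> L" by (simp add: L_def)
  have "((\<lambda>x. L * (1 - \<beta> x)) \<longlongrightarrow> L * (1 - 1)) F" by (intro tendsto_intros beta_tendsto)
  then have "\<forall>\<^sub>F x in F. L * (1 - \<beta> x) < 1 / 2" by (intro order_tendstoD) auto
  with conf far beta_less beta_half s_square
  have *: "\<forall>\<^sub>F x in F. \<bar>Re (\<zeta> j x)\<bar> \<le> (3 + 4 * L) * (s x)\<^sup>2 \<and> (Im (\<zeta> j x))\<^sup>2 \<le> (4 + 20 * L) * (s x)\<^sup>2"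
  proof eventually_elim
    case (elim x)
    let ?w = "of_real (\<beta> x) - \<zeta> j x"
    have "1 - L * (1 - \<beta> x) \<le> Re (1 / ?w)"
      using config_Re_inverse[OF elim(1), of j] elim n j by (simp add: L_def distrib_right)
    then have "\<bar>Re ?w - 1\<bar> \<le> (2 + 4 * L) * (1 - \<beta> x)" "(Im ?w)\<^sup>2 \<le> (4 + 20 * L) * (1 - \<beta> x)"
      using near_one_of_Re_inverse[of "1 - \<beta> x" L ?w] elim j L by auto
    moreover have "(3 + 4 * L) * (1 - \<beta> x) = (2 + 4 * L) * (1 - \<beta> x) + (1 - \<beta> x)"
      by (simp add: algebra_simps)
    ultimately show ?case
      using elim by (simp add: abs_le_iff)
  qed
  show "of_order 2 (\<lambda>x. Re (\<zeta> j x))"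
    by (rule of_orderI[of _ "3 + 4 * L"]) (use * in \<open>auto elim: eventually_mono\<close>)
  have "\<forall>\<^sub>F x in F. norm (Im (\<zeta> j x)) \<le> sqrt (4 + 20 * L) * s x ^ 1"
    using * s_nonneg
  proof eventually_elim
    case (elim x)
    have "\<bar>Im (\<zeta> j x)\<bar> \<le> sqrt ((4 + 20 * L) * (s x)\<^sup>2)"
      using elim by (intro real_le_rsqrt) auto
    then show ?case using elim by (simp add: real_sqrt_mult)
  qed
  then show "of_order 1 (\<lambda>x. Im (\<zeta> j x))" by (rule of_orderI)
qed

definition p :: "nat \<Rightarrow> 'x \<Rightarrow> complex" where
  "p k x = rcoeff (n - 1) (\<lambda>j. \<zeta> j x) k"

lemma p_zero: "p 0 x = 1" by (simp add: p_def rcoeff_zero)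

lemma p_order: "of_order k (p k)"
  unfolding p_def[abs_def] by (intro rcoeff_of_order critical_point_orders)

lemma Re_p_order: "3 \<le> k \<Longrightarrow> of_order 4 (\<lambda>x. Re (p k x))"
  unfolding p_def[abs_def] by (intro Re_rcoeff_of_order critical_point_orders)

lemma beta_order: "of_order 2 (\<lambda>x. \<beta> x - 1)"
proof (rule of_orderI[of _ 1])
  show "\<forall>\<^sub>F x in F. norm (\<beta> x - 1) \<le> 1 * (s x)\<^sup>2"
    using s_square beta_less by eventually_elim simp
qed

lemma beta_power_order: "of_order 2 (\<lambda>x. of_real (\<beta> x) ^ k - 1 :: complex)"
proof -
  have b: "of_order 0 \<beta>"
    using of_order_add[OF of_order_weaken[OF beta_order, of 0] of_order_const[of 1]] by simp
  have "of_order 2 (\<lambda>x. of_real (\<beta> x) - 1 :: complex)"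
    using of_order_of_real[OF beta_order] by simp
  from of_order_power_diff[OF this of_order_of_real[OF b] of_order_const, of k]
  show ?thesis by simp
qed

lemma beta_power_expansion: "of_order 4 (\<lambda>x. \<beta> x ^ k - 1 + real k * (s x)\<^sup>2)"
proof (induction k)
  case (Suc k)
  have b: "of_order 0 \<beta>"
    using of_order_add[OF of_order_weaken[OF beta_order, of 0] of_order_const[of 1]] by simp
  have "of_order 4 (\<lambda>x. \<beta> x * (\<beta> x ^ k - 1 + real k * (s x)\<^sup>2) + real k * (s x ^ 2 * s x ^ 2))"
    by (intro of_order_add of_order_mult[OF b Suc] of_order_cmult
        of_order_mult[OF of_order_scale of_order_scale]) auto
  moreover have "\<forall>\<^sub>F x in F. \<beta> x ^ Suc k - 1 + real (Suc k) * (s x)\<^sup>2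
      = \<beta> x * (\<beta> x ^ k - 1 + real k * (s x)\<^sup>2) + real k * (s x ^ 2 * s x ^ 2)"
    using s_square by eventually_elim (simp, simp add: algebra_simps)
  ultimately show ?case by (rule of_order_cong)
qed (simp add: of_order_zero)

text \<open>The equation is that of a root of the polynomial, solved for \<open>u^n\<close>.\<close>

definition root_near :: "complex \<Rightarrow> ('x \<Rightarrow> complex) \<Rightarrow> bool" where
  "root_near \<omega> u \<longleftrightarrow> (u \<longlongrightarrow> \<omega>) F \<and> (\<forall>\<^sub>F x in F. norm (u x) \<le> 1) \<and>
     (\<forall>\<^sub>F x in F. u x ^ n = of_real (\<beta> x) ^ n
        - (\<Sum>k\<in>{1..<n}. of_nat n / of_nat (n - k) * p k x * (u x ^ (n - k) - of_real (\<beta> x) ^ (n - k))))"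

lemma root_near_exists:
  assumes "\<omega> ^ n = 1"
  shows "\<exists>u. root_near \<omega> u"
proof -
  let ?P = "\<lambda>x w. (w - of_real (\<beta> x)) * (\<Prod>k<n-1. w - z k x)"
  let ?T = "\<lambda>x w. \<Sum>k\<in>{1..<n}. of_nat n / of_nat (n - k) * p k x * (w ^ (n - k) - of_real (\<beta> x) ^ (n - k))"
  have exp: "\<forall>\<^sub>F x in F. \<forall>w. ?P x w = w ^ n - of_real (\<beta> x) ^ n + ?T x w"
    using conf
  proof eventually_elim
    case (elim x)
    have "{..<n} = insert 0 {1..<n}" using n by auto
    show ?case
    proof
      fix w
      have "?P x w = (\<Sum>k<n. of_nat n / of_nat (n - k) * p k x * (w ^ (n - k) - of_real (\<beta> x) ^ (n - k)))"
        unfolding p_def by (rule config_expansion[OF elim]) (use n in simp)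
      with \<open>{..<n} = insert 0 {1..<n}\<close> n show "?P x w = w ^ n - of_real (\<beta> x) ^ n + ?T x w"
        by (simp add: p_zero)
    qed
  qed
  define u where "u x = (SOME u. norm u \<le> 1 \<and> ?P x u = 0 \<and> norm (\<omega> - u) ^ n \<le> norm (?P x \<omega>))" for x
  have u: "\<forall>\<^sub>F x in F. norm (u x) \<le> 1 \<and> ?P x (u x) = 0 \<and> norm (\<omega> - u x) ^ n \<le> norm (?P x \<omega>)"
    using conf beta_less beta_half
  proof eventually_elim
    case (elim x)
    show ?case unfolding u_def
      by (rule someI_ex, rule config_root_close[OF elim(1)]) (use elim n in auto)
  qed
  have "of_order 1 (\<lambda>x. - (of_real (\<beta> x) ^ n - 1) + ?T x \<omega>)"
  proof (intro of_order_add of_order_minus of_order_sum)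
    show "of_order 1 (\<lambda>x. of_real (\<beta> x) ^ n - 1 :: complex)"
      by (rule of_order_weaken[OF beta_power_order]) simp
    fix k assume k: "k \<in> {1..<n}"
    have 1: "of_order 0 (\<lambda>x. (\<omega> ^ (n - k) - 1) - (of_real (\<beta> x) ^ (n - k) - 1))"
      by (intro of_order_diff of_order_const of_order_weaken[OF beta_power_order]) simp
    have "of_order 1 (\<lambda>x. of_nat n / of_nat (n - k) * p k x * ((\<omega> ^ (n - k) - 1) - (of_real (\<beta> x) ^ (n - k) - 1)))"
      by (rule of_order_mult[OF of_order_cmult[OF p_order] 1]) (use k in auto)
    then show "of_order 1 (\<lambda>x. of_nat n / of_nat (n - k) * p k x * (\<omega> ^ (n - k) - of_real (\<beta> x) ^ (n - k)))"
      by simp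
  qed
  then have "of_order 1 (\<lambda>x. ?P x \<omega>)"
    by (rule of_order_cong) (use exp assms in \<open>auto elim!: eventually_mono\<close>)
  then have P0: "((\<lambda>x. ?P x \<omega>) \<longlongrightarrow> 0) F" by (rule of_order_tendsto_zero) simp
  have "((\<lambda>x. norm (\<omega> - u x) ^ n) \<longlongrightarrow> 0) F"
    by (rule Lim_null_comparison[OF _ tendsto_norm_zero[OF P0]]) (use u in \<open>auto elim!: eventually_mono\<close>)
  then have "((\<lambda>x. root n (norm (\<omega> - u x) ^ n)) \<longlongrightarrow> root n 0) F"
    by (intro tendsto_intros)
  then have "((\<lambda>x. norm (\<omega> - u x)) \<longlongrightarrow> 0) F"
    using n by (simp add: real_root_power_cancel)
  then have lim: "(u \<longlongrightarrow> \<omega>) F"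
    by (subst tendsto_dist_iff) (simp add: dist_norm norm_minus_commute)
  have "\<forall>\<^sub>F x in F. u x ^ n = of_real (\<beta> x) ^ n - ?T x (u x)"
    using exp u
  proof eventually_elim
    case (elim x)
    then have "u x ^ n - of_real (\<beta> x) ^ n + ?T x (u x) = 0" by metis
    moreover have "a = b - t" if "a - b + t = 0" for a b t :: complex
      using that by (simp add: algebra_simps eq_neg_iff_add_eq_0)
    ultimately show ?case by blast
  qed
  moreover have "\<forall>\<^sub>F x in F. norm (u x) \<le> 1" using u by (auto elim!: eventually_mono)
  ultimately show ?thesis using lim unfolding root_near_def by blast
qed

text \<open>The root equation gives \<open>u^n - 1\<close> the order of the coefficients, and \<open>u^n - \<omega>^n\<close> is \<open>u - \<omega>\<close> times a factor
  tending to \<open>n \<omega>^(n-1)\<close>, of modulus \<open>n > 1\<close>. The bound \<open>i \<le> 2\<close> comes from \<open>\<beta>^n - 1\<close>, which has order 2.\<close>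

lemma root_near_order:
  assumes "root_near \<omega> u" "\<omega> ^ n = 1" "i \<le> 2"
    and p: "\<And>k. 1 \<le> k \<Longrightarrow> k < n \<Longrightarrow> of_order i (p k)"
  shows "of_order i (\<lambda>x. u x - \<omega>)"
proof -
  let ?T = "\<lambda>x. \<Sum>k\<in>{1..<n}. of_nat n / of_nat (n - k) * p k x * (u x ^ (n - k) - of_real (\<beta> x) ^ (n - k))"
  let ?S = "\<lambda>x. \<Sum>i<n. \<omega> ^ (n - Suc i) * u x ^ i"
  have lim: "(u \<longlongrightarrow> \<omega>) F" and bd: "\<forall>\<^sub>F x in F. norm (u x) \<le> 1"
    and eq: "\<forall>\<^sub>F x in F. u x ^ n = of_real (\<beta> x) ^ n - ?T x"
    using assms(1) by (simp_all add: root_near_def)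
  have pow: "of_order 0 (\<lambda>x. u x ^ k)" for k
    by (rule of_orderI[of _ 1]) (use bd in \<open>auto elim!: eventually_mono simp: norm_power power_le_one\<close>)
  have "of_order i (\<lambda>x. (of_real (\<beta> x) ^ n - 1) - ?T x)"
  proof (rule of_order_diff[OF of_order_weaken[OF beta_power_order \<open>i \<le> 2\<close>] of_order_sum])
    fix k assume k: "k \<in> {1..<n}"
    have 1: "of_order 0 (\<lambda>x. u x ^ (n - k) - ((of_real (\<beta> x) ^ (n - k) - 1) + 1))"
      by (intro of_order_diff of_order_add of_order_const pow of_order_weaken[OF beta_power_order]) simp
    have "of_order i (\<lambda>x. of_nat n / of_nat (n - k) * p k x * (u x ^ (n - k) - ((of_real (\<beta> x) ^ (n - k) - 1) + 1)))"
      by (rule of_order_mult[OF of_order_cmult[OF p] 1]) (use k in auto)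
    then show "of_order i (\<lambda>x. of_nat n / of_nat (n - k) * p k x * (u x ^ (n - k) - of_real (\<beta> x) ^ (n - k)))"
      by simp
  qed
  then have un: "of_order i (\<lambda>x. u x ^ n - \<omega> ^ n)"
    by (rule of_order_cong) (use eq assms(2) in \<open>auto elim!: eventually_mono\<close>)
  have norm_om: "norm \<omega> = 1"
    using power_eq_1_iff[OF assms(2)] n by simp
  have "(?S \<longlongrightarrow> (\<Sum>i<n. \<omega> ^ (n - Suc i) * \<omega> ^ i)) F" by (intro tendsto_intros lim)
  also have "(\<Sum>i<n. \<omega> ^ (n - Suc i) * \<omega> ^ i) = of_nat n * \<omega> ^ (n - 1)"
    by (simp add: power_add[symmetric])
  finally have "((\<lambda>x. norm (?S x)) \<longlongrightarrow> norm (of_nat n * \<omega> ^ (n - 1))) F" by (rule tendsto_norm)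
  moreover have "norm (of_nat n * \<omega> ^ (n - 1)) > 1"
    using n by (simp add: norm_mult norm_power norm_om)
  ultimately have S1: "\<forall>\<^sub>F x in F. 1 < norm (?S x)" by (rule order_tendstoD(1))
  show ?thesis
  proof (rule of_order_dominated[OF un])
    show "\<forall>\<^sub>F x in F. norm (u x - \<omega>) \<le> 1 * norm (u x ^ n - \<omega> ^ n)"
      using S1
    proof eventually_elim
      case (elim x)
      have "norm (u x - \<omega>) * 1 \<le> norm (u x - \<omega>) * norm (?S x)"
        using elim by (intro mult_left_mono) auto
      also have "\<dots> = norm (u x ^ n - \<omega> ^ n)"
        by (subst power_diff_sumr2) (simp add: norm_mult)
      finally show ?case by simp
    qed
  qed simp
qed

text \<open>Replacing \<open>u\<close> by \<open>\<omega>\<close> and \<open>\<beta>\<close> by 1 inside the brackets of the root equation costs a coefficient of order \<open>i\<close> times a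
  displacement of order \<open>i\<close>. What is left is at most 1 in real part since \<open>\<bar>u\<bar> \<le> 1\<close>. It is applied with
  \<open>i = 1\<close> first, to improve the order of the coefficients, and then with \<open>i = 2\<close>.\<close>

lemma root_inequality:
  assumes "\<omega> ^ n = 1" "i \<le> 2" and p: "\<And>k. 1 \<le> k \<Longrightarrow> k < n \<Longrightarrow> of_order i (p k)"
  shows "le_order (2 * i) (\<lambda>x. \<beta> x ^ n - 1
    + (\<Sum>k\<in>{1..<n}. real n / real (n - k) * Re (p k x * (1 - \<omega> ^ (n - k)))))"
proof -
  obtain u where u: "root_near \<omega> u" using root_near_exists[OF assms(1)] by blast
  have bd: "\<forall>\<^sub>F x in F. norm (u x) \<le> 1"
    and eq: "\<forall>\<^sub>F x in F. u x ^ n = of_real (\<beta> x) ^ n - (\<Sum>k\<in>{1..<n}. of_nat n / of_nat (n - k) * p k x * (u x ^ (n - k) - of_real (\<beta> x) ^ (n - k)))"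
    using u by (simp_all add: root_near_def)
  have d: "of_order i (\<lambda>x. u x - \<omega>)" by (rule root_near_order[OF u assms])
  have u0: "of_order 0 u"
    by (rule of_orderI[of _ 1]) (use bd in \<open>auto elim!: eventually_mono\<close>)
  have "of_order (2 * i) (\<lambda>x. \<Sum>k\<in>{1..<n}. of_nat n / of_nat (n - k) * p k x *
      ((u x ^ (n - k) - \<omega> ^ (n - k)) - (of_real (\<beta> x) ^ (n - k) - 1)))"
  proof (intro of_order_sum)
    fix k assume k: "k \<in> {1..<n}"
    have 1: "of_order i (\<lambda>x. (u x ^ (n - k) - \<omega> ^ (n - k)) - (of_real (\<beta> x) ^ (n - k) - 1))"
      by (intro of_order_diff of_order_power_diff d u0 of_order_const of_order_weaken[OF beta_power_order assms(2)])
    show "of_order (2 * i) (\<lambda>x. of_nat n / of_nat (n - k) * p k x *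
      ((u x ^ (n - k) - \<omega> ^ (n - k)) - (of_real (\<beta> x) ^ (n - k) - 1)))"
      by (rule of_order_mult[OF of_order_cmult[OF p] 1]) (use k in auto)
  qed
  then have small: "of_order (2 * i) (\<lambda>x. Re (\<Sum>k\<in>{1..<n}. of_nat n / of_nat (n - k) * p k x *
      ((u x ^ (n - k) - \<omega> ^ (n - k)) - (of_real (\<beta> x) ^ (n - k) - 1))))"
    by (rule of_order_Re)
  have "le_order (2 * i) (\<lambda>x. Re (u x ^ n) - 1)"
    unfolding le_order_def
  proof (intro exI[of _ 0])
    show "\<forall>\<^sub>F x in F. Re (u x ^ n) - 1 \<le> 0 * s x ^ (2 * i)"
      using bd
    proof eventually_elim
      case (elim x)
      have "Re (u x ^ n) \<le> norm (u x ^ n)" by (rule complex_Re_le_cmod)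
      also have "\<dots> \<le> 1" using elim by (simp add: norm_power power_le_one)
      finally show ?case by simp
    qed
  qed
  then show ?thesis
  proof (rule le_order_perturb)
    show "of_order (2 * i) (\<lambda>x. \<beta> x ^ n - 1
      + (\<Sum>k\<in>{1..<n}. real n / real (n - k) * Re (p k x * (1 - \<omega> ^ (n - k)))) - (Re (u x ^ n) - 1))"
    proof (rule of_order_cong[OF small])
      show "\<forall>\<^sub>F x in F. \<beta> x ^ n - 1
        + (\<Sum>k\<in>{1..<n}. real n / real (n - k) * Re (p k x * (1 - \<omega> ^ (n - k)))) - (Re (u x ^ n) - 1)
        = Re (\<Sum>k\<in>{1..<n}. of_nat n / of_nat (n - k) * p k x *
      ((u x ^ (n - k) - \<omega> ^ (n - k)) - (of_real (\<beta> x) ^ (n - k) - 1)))"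
        using eq
      proof eventually_elim
        case (elim x)
        have 1: "real n / real (n - k) * Re c = Re (of_nat n / of_nat (n - k) * c)" for k c
        proof -
          have "of_nat n / of_nat (n - k) = (of_real (real n / real (n - k)) :: complex)" by simp
          then show ?thesis by (simp only: Re_complex_of_real times_complex.sel Im_complex_of_real) simp
        qed
        have "of_real (\<beta> x) ^ n - 1
            + (\<Sum>k\<in>{1..<n}. of_nat n / of_nat (n - k) * (p k x * (1 - \<omega> ^ (n - k)))) - (u x ^ n - 1)
          = (\<Sum>k\<in>{1..<n}. of_nat n / of_nat (n - k) * (p k x * (1 - \<omega> ^ (n - k))))
            + (\<Sum>k\<in>{1..<n}. of_nat n / of_nat (n - k) * p k x * (u x ^ (n - k) - of_real (\<beta> x) ^ (n - k)))"
        proof -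
          have "b - 1 + A - (b - B - 1) = A + B" for b A B :: complex by simp
          then show ?thesis unfolding elim .
        qed
        also have "\<dots> = (\<Sum>k\<in>{1..<n}. of_nat n / of_nat (n - k) * p k x *
            ((u x ^ (n - k) - \<omega> ^ (n - k)) - (of_real (\<beta> x) ^ (n - k) - 1)))"
        proof -
          have "C * (q * (1 - w)) + C * q * (v - b) = C * q * ((v - w) - (b - 1))" for C q w v b :: complex
            by (simp add: algebra_simps)
          then show ?thesis unfolding sum.distrib[symmetric] by (simp only:)
        qed
        finally have "Re (of_real (\<beta> x) ^ n - 1
            + (\<Sum>k\<in>{1..<n}. of_nat n / of_nat (n - k) * (p k x * (1 - \<omega> ^ (n - k)))) - (u x ^ n - 1))
          = Re (\<Sum>k\<in>{1..<n}. of_nat n / of_nat (n - k) * p k x *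
            ((u x ^ (n - k) - \<omega> ^ (n - k)) - (of_real (\<beta> x) ^ (n - k) - 1)))" by (rule arg_cong)
        then show ?case
          unfolding 1 by (simp only: Re_sum minus_complex.sel(1) plus_complex.sel(1)
              of_real_power[symmetric] Re_complex_of_real one_complex.sel(1))
      qed
    qed
  qed
qed

lemma p_one: "p 1 x = - (\<Sum>j<n-1. \<zeta> j x)"
  by (simp add: p_def rcoeff_one)

lemma Re_p_one_order: "of_order 2 (\<lambda>x. Re (p 1 x))"
  unfolding p_one uminus_complex.sel Re_sum
  by (intro of_order_minus of_order_sum critical_point_orders) simp

text \<open>To first order, \<open>Im p\<^sub>1\<close> moves the roots near \<open>\<omega>\<close> and near its conjugate in opposite radial directions, one of them
  out of the disk; so it has to be of second order. Here \<open>n \<ge> 3\<close> supplies a non-real root of unity.\<close>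

lemma Im_p_one_order: "of_order 2 (\<lambda>x. Im (p 1 x))"
proof -
  have one_sided: "le_order 2 (\<lambda>x. - Im \<omega> * Im (p 1 x))" if w: "\<omega> ^ n = 1" for \<omega>
  proof -
    let ?r = "\<lambda>k x. real n / real (n - k) * Re (p k x * (1 - \<omega> ^ (n - k)))"
    have "le_order (2 * 1) (\<lambda>x. \<beta> x ^ n - 1 + (\<Sum>k\<in>{1..<n}. ?r k x))"
      by (rule root_inequality[OF w]) (auto intro: of_order_weaken[OF p_order])
    then have main: "le_order 2 (\<lambda>x. \<beta> x ^ n - 1 + (\<Sum>k\<in>{1..<n}. ?r k x))" by simp
    have small: "of_order 2 (\<lambda>x. - (Re (of_real (\<beta> x) ^ n - 1)) - real n / real (n - 1) * ((1 - Re \<omega>) * Re (p 1 x))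
       - (\<Sum>k\<in>{2..<n}. real n / real (n - k) * Re ((1 - \<omega> ^ (n - k)) * p k x)))"
      by (intro of_order_diff of_order_minus of_order_Re beta_power_order of_order_cmult Re_p_one_order
          of_order_sum of_order_weaken[OF p_order]) simp
    have split: "{1..<n} = insert 1 {2..<n}" using n by auto
    have c: "\<omega> ^ (n - 1) = cnj \<omega>" using root_of_unity_power_diff[OF w, of 1] n by simp
    have "le_order 2 (\<lambda>x. real n / real (n - 1) * (- Im \<omega> * Im (p 1 x)))"
    proof (rule le_order_perturb[OF main], rule of_order_cong[OF small], intro always_eventually allI)
      fix x
      have r1: "?r 1 x = real n / real (n - 1) * (- Im \<omega> * Im (p 1 x)) + real n / real (n - 1) * ((1 - Re \<omega>) * Re (p 1 x))"
        unfolding c by (simp only: distrib_left[symmetric]) (simp add: algebra_simps)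
      have "(\<Sum>k\<in>{1..<n}. ?r k x) = ?r 1 x + (\<Sum>k\<in>{2..<n}. ?r k x)"
        unfolding split by simp
      then show "real n / real (n - 1) * (- Im \<omega> * Im (p 1 x)) - (\<beta> x ^ n - 1 + (\<Sum>k\<in>{1..<n}. ?r k x))
        = - (Re (of_real (\<beta> x) ^ n - 1)) - real n / real (n - 1) * ((1 - Re \<omega>) * Re (p 1 x))
       - (\<Sum>k\<in>{2..<n}. real n / real (n - k) * Re ((1 - \<omega> ^ (n - k)) * p k x))"
        unfolding r1 by (simp only: mult.commute[of "p _ x"] of_real_power[symmetric]
            minus_complex.sel Re_complex_of_real one_complex.sel) argo
    qed
    moreover have "real (n - 1) / real n * (real n / real (n - 1) * y) = y" for y
      using n by simp
    ultimately show ?thesis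
      using le_order_cmult[of 2 _ "real (n - 1) / real n"] by fastforce
  qed
  let ?w = "cis (2 * pi / real n)"
  have w: "?w ^ n = 1" using cis_root_of_unity[of n 1] n by simp
  then have w': "cnj ?w ^ n = 1" by (metis complex_cnj_one complex_cnj_power)
  have "of_order 2 (\<lambda>x. - Im ?w * Im (p 1 x))"
    by (rule of_order_if_le_order[OF one_sided[OF w]]) (use one_sided[OF w'] in simp)
  moreover have "Im ?w \<noteq> 0"
    using sin_gt_zero[of "2 * pi / real n"] n by (simp add: field_simps)
  ultimately show ?thesis
    using of_order_cmult[of 2 "\<lambda>x. - Im ?w * Im (p 1 x)" "- 1 / Im ?w"] by simp
qed

lemma p_order_two: "1 \<le> k \<Longrightarrow> of_order 2 (p k)"
  using of_order_complex[OF Re_p_one_order Im_p_one_order] of_order_weaken[OF p_order, of 2 k]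
  by (cases "k = 1") auto

text \<open>The imaginary parts of the critical points are of order \<open>s\<close>, so their squares contribute at the order \<open>\<epsilon> = s^2\<close> of
  the theorem; the sum of the squares is the only trace that they leave in the final inequality.\<close>

definition spread :: "'x \<Rightarrow> real" where
  "spread x = (\<Sum>j<n-1. (Im (\<zeta> j x))\<^sup>2)"

definition defect :: "'x \<Rightarrow> real" where
  "defect x = (\<Sum>j<n-1. 1 - (norm (of_real (\<beta> x) - \<zeta> j x))\<^sup>2)"

text \<open>Since \<open>\<beta> = 1 - s^2\<close>, the summand of the defect is \<open>2 s^2 + 2 Re \<zeta>\<^sub>j - (Im \<zeta>\<^sub>j)^2\<close> up to a square of order 4.\<close>

lemma Re_p_one_expansion:
  "of_order 4 (\<lambda>x. Re (p 1 x) + (defect x / 2 - real (n - 1) * (s x)\<^sup>2 + spread x / 2))"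
proof -
  have sum: "of_order 4 (\<lambda>x. - (\<Sum>j<n-1. ((s x)\<^sup>2 + Re (\<zeta> j x)) * ((s x)\<^sup>2 + Re (\<zeta> j x))) / 2)"
    using of_order_cmult[of 4 "\<lambda>x. \<Sum>j<n-1. ((s x)\<^sup>2 + Re (\<zeta> j x)) * ((s x)\<^sup>2 + Re (\<zeta> j x))" "- 1 / 2"]
      of_order_sum[of "{..<n-1}" 4 "\<lambda>j x. ((s x)\<^sup>2 + Re (\<zeta> j x)) * ((s x)\<^sup>2 + Re (\<zeta> j x))"]
      of_order_mult[OF of_order_add[OF of_order_scale critical_point_orders(1)]
        of_order_add[OF of_order_scale critical_point_orders(1)], of _ _ 4]
    by simp
  show ?thesis
  proof (rule of_order_cong[OF sum])
    show "\<forall>\<^sub>F x in F. Re (p 1 x) + (defect x / 2 - real (n - 1) * (s x)\<^sup>2 + spread x / 2)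
      = - (\<Sum>j<n-1. ((s x)\<^sup>2 + Re (\<zeta> j x)) * ((s x)\<^sup>2 + Re (\<zeta> j x))) / 2"
      using s_square
    proof eventually_elim
      case (elim x)
      have "1 - (norm (of_real (\<beta> x) - \<zeta> j x))\<^sup>2 + (Im (\<zeta> j x))\<^sup>2
        = 2 * (s x)\<^sup>2 + 2 * Re (\<zeta> j x) - ((s x)\<^sup>2 + Re (\<zeta> j x)) * ((s x)\<^sup>2 + Re (\<zeta> j x))" for j
      proof -
        have b: "\<beta> x = 1 - (s x)\<^sup>2" using elim by simp
        show ?thesis
          unfolding cmod_power2 b by (simp add: power2_eq_square algebra_simps)
      qed
      then have "defect x + spread x = (\<Sum>j<n-1. 2 * (s x)\<^sup>2 + 2 * Re (\<zeta> j x)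
          - ((s x)\<^sup>2 + Re (\<zeta> j x)) * ((s x)\<^sup>2 + Re (\<zeta> j x)))"
        unfolding defect_def spread_def by (simp only: sum.distrib[symmetric])
      also have "\<dots> = real (n - 1) * (2 * (s x)\<^sup>2) - 2 * Re (p 1 x)
          - (\<Sum>j<n-1. ((s x)\<^sup>2 + Re (\<zeta> j x)) * ((s x)\<^sup>2 + Re (\<zeta> j x)))"
        unfolding p_one by (simp only: sum.distrib sum_subtractf sum_distrib_left[symmetric] sum_constant
            card_lessThan uminus_complex.sel Re_sum)
      finally show ?case by simp
    qed
  qed
qed

lemma Re_p_two_expansion: "of_order 4 (\<lambda>x. Re (p 2 x) - spread x / 2)"
proof -
  have sum: "of_order 4 (\<lambda>x. Re (p 1 x * p 1 x) * (1 / 2) - (\<Sum>j<n-1. Re (\<zeta> j x) * Re (\<zeta> j x)) * (1 / 2))"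
    by (intro of_order_diff of_order_mult[OF _ of_order_const, where k = 4] of_order_Re of_order_sum
        of_order_mult[OF p_order_two p_order_two]
        of_order_mult[OF critical_point_orders(1) critical_point_orders(1)]) simp_all
  show ?thesis
  proof (rule of_order_cong[OF sum], intro always_eventually allI)
    fix x
    have "2 * p 2 x = p 1 x * p 1 x - (\<Sum>j<n-1. (\<zeta> j x)\<^sup>2)"
      unfolding p_one using rcoeff_two[of "n - 1" "\<lambda>j. \<zeta> j x"]
      by (simp add: p_def numeral_2_eq_2 power2_eq_square)
    then have "2 * Re (p 2 x) = Re (p 1 x * p 1 x) - Re (\<Sum>j<n-1. (\<zeta> j x)\<^sup>2)"
      by (metis Re_divide_numeral minus_complex.sel(1) nonzero_mult_div_cancel_left zero_neq_numeral times_divide_eq_right)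
    moreover have "Re (\<Sum>j<n-1. (\<zeta> j x)\<^sup>2) = (\<Sum>j<n-1. Re (\<zeta> j x) * Re (\<zeta> j x)) - spread x"
      by (simp add: spread_def power2_eq_square sum_subtractf)
    ultimately show "Re (p 2 x) - spread x / 2
      = Re (p 1 x * p 1 x) * (1 / 2) - (\<Sum>j<n-1. Re (\<zeta> j x) * Re (\<zeta> j x)) * (1 / 2)" by argo
  qed
qed

text \<open>Adding the inequalities for \<open>\<omega>\<close> and its conjugate leaves only the real parts of the coefficients, and those are of
  order 4 from \<open>p\<^sub>3\<close> on.\<close>

lemma symmetrized_inequality:
  assumes w: "\<omega> ^ n = 1"
  shows "le_order 4 (\<lambda>x. - (s x)\<^sup>2 + (1 - Re \<omega>) / real (n - 1) * Re (p 1 x)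
    + 2 * (1 - (Re \<omega>)\<^sup>2) / real (n - 2) * Re (p 2 x))"
proof -
  let ?c = "\<lambda>k. real n / real (n - k)"
  let ?r = "\<lambda>\<omega> k x. ?c k * Re (p k x * (1 - \<omega> ^ (n - k)))"
  have one: "le_order 4 (\<lambda>x. \<beta> x ^ n - 1 + (\<Sum>k\<in>{1..<n}. ?r v k x))" if "v ^ n = 1" for v
    using root_inequality[OF that, of 2] p_order_two by simp
  have w': "cnj \<omega> ^ n = 1" using w by (metis complex_cnj_one complex_cnj_power)
  have n1: "norm \<omega> = 1" using power_eq_1_iff[OF w] n by simp
  have R1: "Re (\<omega> ^ (n - 1)) = Re \<omega>" using root_of_unity_power_diff[OF w, of 1] n by simp
  have R2: "1 - Re (\<omega> ^ (n - 2)) = 2 * (1 - (Re \<omega>)\<^sup>2)"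
  proof -
    have "(Re \<omega>)\<^sup>2 + (Im \<omega>)\<^sup>2 = 1" using n1 by (simp add: cmod_power2[symmetric])
    then show ?thesis
      using root_of_unity_power_diff[OF w, of 2] n by (simp add: power2_eq_square)
  qed
  have split: "{1..<n} = insert 1 (insert 2 {3..<n})" using n by auto
  let ?main = "\<lambda>x. - real n * (s x)\<^sup>2 + ?c 1 * ((1 - Re \<omega>) * Re (p 1 x)) + ?c 2 * (2 * (1 - (Re \<omega>)\<^sup>2) * Re (p 2 x))"
  have small: "of_order 4 (\<lambda>x. - 2 * (\<beta> x ^ n - 1 + real n * (s x)\<^sup>2)
      - (\<Sum>k\<in>{3..<n}. 2 * ?c k * (1 - Re (\<omega> ^ (n - k))) * Re (p k x)))"
    by (intro of_order_diff of_order_cmult beta_power_expansion of_order_sum Re_p_order) simp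
  have "le_order 4 (\<lambda>x. 2 * ?main x)"
  proof (rule le_order_perturb[OF le_order_add[OF one[OF w] one[OF w']]], rule of_order_cong[OF small],
      intro always_eventually allI)
    fix x
    have "(\<Sum>k\<in>{1..<n}. ?r \<omega> k x) + (\<Sum>k\<in>{1..<n}. ?r (cnj \<omega>) k x)
      = (\<Sum>k\<in>{1..<n}. 2 * ?c k * (1 - Re (\<omega> ^ (n - k))) * Re (p k x))"
      unfolding sum.distrib[symmetric]
    proof (intro sum.cong refl)
      fix k
      have "C * Re (q * (1 - v)) + C * Re (q * (1 - cnj v)) = 2 * C * (1 - Re v) * Re q" for C q v
        by (simp add: algebra_simps)
      then show "?r \<omega> k x + ?r (cnj \<omega>) k x = 2 * ?c k * (1 - Re (\<omega> ^ (n - k))) * Re (p k x)"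
        unfolding complex_cnj_power[symmetric] .
    qed
    also have "\<dots> = 2 * (?c 1 * ((1 - Re \<omega>) * Re (p 1 x))) + 2 * (?c 2 * (2 * (1 - (Re \<omega>)\<^sup>2) * Re (p 2 x)))
        + (\<Sum>k\<in>{3..<n}. 2 * ?c k * (1 - Re (\<omega> ^ (n - k))) * Re (p k x))"
    proof -
      have "(\<Sum>k\<in>{1..<n}. g k) = g 1 + g 2 + (\<Sum>k\<in>{3..<n}. g k)" for g :: "nat \<Rightarrow> real"
        unfolding split by simp
      then show ?thesis by (simp only: R1 R2 mult.assoc)
    qed
    finally show "2 * ?main x - (\<beta> x ^ n - 1 + (\<Sum>k\<in>{1..<n}. ?r \<omega> k x) + (\<beta> x ^ n - 1 + (\<Sum>k\<in>{1..<n}. ?r (cnj \<omega>) k x)))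
      = - 2 * (\<beta> x ^ n - 1 + real n * (s x)\<^sup>2)
      - (\<Sum>k\<in>{3..<n}. 2 * ?c k * (1 - Re (\<omega> ^ (n - k))) * Re (p k x))" by argo
  qed
  from le_order_cmult[OF this, of "1 / (2 * real n)"]
  have "le_order 4 (\<lambda>x. 1 / (2 * real n) * (2 * ?main x))" by simp
  moreover have "1 / (2 * real n) * (2 * ?main x) = - (s x)\<^sup>2 + (1 - Re \<omega>) / real (n - 1) * Re (p 1 x)
    + 2 * (1 - (Re \<omega>)\<^sup>2) / real (n - 2) * Re (p 2 x)" for x
  proof -
    have "1 / (2 * N) * (2 * (- N * e + N / a * A + N / b * B)) = - e + A / a + B / b"
      if "N > 0" "a > 0" "b > 0" for N e a b A B :: real
      using that by (simp add: field_simps)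
    from this[of "real n" "real (n - 1)" "real (n - 2)"] show ?thesis using n by simp
  qed
  ultimately show ?thesis by simp
qed

lemma defect_inequality:
  assumes w: "\<omega> ^ n = 1" and c: "Re \<omega> < 1"
  shows "le_order 4 (\<lambda>x. (s x)\<^sup>2 - defect x / (2 * real (n - 1)) - (s x)\<^sup>2 / (1 - Re \<omega>)
    - spread x * (1 / (2 * real (n - 1)) - (1 + Re \<omega>) / real (n - 2)))"
proof -
  define t where "t = 1 - Re \<omega>"
  have t: "t > 0" using c by (simp add: t_def)
  define a b where "a = real (n - 1)" and "b = real (n - 2)"
  have ab: "a > 0" "b > 0" using n by (auto simp: a_def b_def)
  let ?E = "\<lambda>x. defect x / 2 - a * (s x)\<^sup>2 + spread x / 2"
  have sq: "2 * (1 - (Re \<omega>)\<^sup>2) = 2 * t * (1 + Re \<omega>)" by (simp add: t_def power2_eq_square algebra_simps)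
  have "le_order 4 (\<lambda>x. - (s x)\<^sup>2 + t / a * Re (p 1 x) + 2 * t * (1 + Re \<omega>) / b * Re (p 2 x))"
    using symmetrized_inequality[OF w] unfolding sq by (simp add: t_def a_def b_def)
  moreover have small: "of_order 4 (\<lambda>x. - (t / a) * (Re (p 1 x) + ?E x) - 2 * t * (1 + Re \<omega>) / b * (Re (p 2 x) - spread x / 2))"
    unfolding a_def by (intro of_order_diff of_order_cmult Re_p_one_expansion Re_p_two_expansion)
  have "le_order 4 (\<lambda>x. - (s x)\<^sup>2 - t / a * ?E x + t * (1 + Re \<omega>) / b * spread x)"
    by (rule le_order_perturb[OF calculation], rule of_order_cong[OF small],
        intro always_eventually allI) (simp add: algebra_simps diff_divide_distrib add_divide_distrib)
  from le_order_cmult[OF this, of "1 / t"] t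
  have "le_order 4 (\<lambda>x. 1 / t * (- (s x)\<^sup>2 - t / a * ?E x + t * (1 + Re \<omega>) / b * spread x))" by simp
  moreover have "1 / t * (- e - t / a * (d / 2 - a * e + v / 2) + t * r / b * v)
    = e - d / (2 * a) - e / t - v * (1 / (2 * a) - r / b)" for e d v r
    using t ab by (simp add: field_simps)
  ultimately show ?thesis unfolding t_def[symmetric] a_def[symmetric] b_def[symmetric] by simp
qed

text \<open>The last hypothesis makes the coefficient of \<open>spread\<close> on the right of the combined inequality nonpositive; as \<open>spread\<close> is
  nonnegative it can be dropped.\<close>

lemma defect_lower_bound:
  assumes "\<omega>\<^sub>1 ^ n = 1" "\<omega>\<^sub>2 ^ n = 1" "Re \<omega>\<^sub>1 < 1" "Re \<omega>\<^sub>2 < 1" "0 \<le> \<mu>" "0 \<le> \<nu>" "\<mu> + \<nu> = 1"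
    and "\<mu> / (1 - Re \<omega>\<^sub>1) + \<nu> / (1 - Re \<omega>\<^sub>2) \<le> 7 / 10"
    and "real (n - 2) / (2 * real (n - 1)) \<le> \<mu> * (1 + Re \<omega>\<^sub>1) + \<nu> * (1 + Re \<omega>\<^sub>2)"
  shows "le_order 4 (\<lambda>x. 3 / 10 * (s x)\<^sup>2 - defect x / (2 * real (n - 1)))"
proof -
  let ?f = "\<lambda>\<omega> x. (s x)\<^sup>2 - defect x / (2 * real (n - 1)) - (s x)\<^sup>2 / (1 - Re \<omega>)
    - spread x * (1 / (2 * real (n - 1)) - (1 + Re \<omega>) / real (n - 2))"
  have "le_order 4 (\<lambda>x. \<mu> * ?f \<omega>\<^sub>1 x + \<nu> * ?f \<omega>\<^sub>2 x)"
    by (intro le_order_add le_order_cmult defect_inequality assms)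
  then show ?thesis
  proof (rule le_order_mono, intro always_eventually allI)
    fix x
    have comb: "\<mu> * (e - d - e / t1 - v * (h - r1 / b)) + \<nu> * (e - d - e / t2 - v * (h - r2 / b))
      = e * (1 - (\<mu> / t1 + \<nu> / t2)) - d + v * ((\<mu> * r1 + \<nu> * r2) / b - h)" for e d t1 t2 v h r1 r2 b
    proof -
      have "\<nu> = 1 - \<mu>" using assms(7) by simp
      show ?thesis
        unfolding \<open>\<nu> = 1 - \<mu>\<close> by (simp add: algebra_simps diff_divide_distrib add_divide_distrib)
    qed
    have "0 \<le> spread x" by (simp add: spread_def sum_nonneg)
    moreover have "1 / (2 * real (n - 1)) \<le> (\<mu> * (1 + Re \<omega>\<^sub>1) + \<nu> * (1 + Re \<omega>\<^sub>2)) / real (n - 2)"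
      using assms(9) n by (simp add: field_simps)
    ultimately have "0 \<le> spread x * ((\<mu> * (1 + Re \<omega>\<^sub>1) + \<nu> * (1 + Re \<omega>\<^sub>2)) / real (n - 2) - 1 / (2 * real (n - 1)))"
      by simp
    moreover have "(s x)\<^sup>2 * (3 / 10) \<le> (s x)\<^sup>2 * (1 - (\<mu> / (1 - Re \<omega>\<^sub>1) + \<nu> / (1 - Re \<omega>\<^sub>2)))"
      using assms(8) by (intro mult_left_mono) auto
    ultimately show "3 / 10 * (s x)\<^sup>2 - defect x / (2 * real (n - 1)) \<le> \<mu> * ?f \<omega>\<^sub>1 x + \<nu> * ?f \<omega>\<^sub>2 x"
      unfolding comb by argo
  qed
qed

end

section \<open>The choice of roots of unity and weights\<close>

text \<open>The hypotheses of the lower bound for the defect. The lower bound for the mean of \<open>1 + Re \<omega>\<close> corresponds to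
  \<open>Re \<omega> = -n/(2(n-1))\<close>, a value that is in general not attained at a root of unity, whence two of them.\<close>

definition good_weights :: "nat \<Rightarrow> complex \<Rightarrow> complex \<Rightarrow> real \<Rightarrow> real \<Rightarrow> bool" where
  "good_weights n \<omega>\<^sub>1 \<omega>\<^sub>2 \<mu> \<nu> \<longleftrightarrow>
     \<omega>\<^sub>1 ^ n = 1 \<and> \<omega>\<^sub>2 ^ n = 1 \<and> Re \<omega>\<^sub>1 < 1 \<and> Re \<omega>\<^sub>2 < 1 \<and> 0 \<le> \<mu> \<and> 0 \<le> \<nu> \<and> \<mu> + \<nu> = 1 \<and>
     \<mu> / (1 - Re \<omega>\<^sub>1) + \<nu> / (1 - Re \<omega>\<^sub>2) \<le> 7 / 10 \<and>
     real (n - 2) / (2 * real (n - 1)) \<le> \<mu> * (1 + Re \<omega>\<^sub>1) + \<nu> * (1 + Re \<omega>\<^sub>2)"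

text \<open>The weights are those for which the mean of \<open>Re \<omega>\<close> is exactly \<open>-c\<close>. Then the mean of \<open>1/t\<close>, with
  \<open>t = 1 - Re \<omega>\<close>, is the value at \<open>1 + c\<close> of the chord of \<open>1/t\<close> through \<open>t\<^sub>1\<close> and \<open>t\<^sub>2\<close>,
  that is \<open>(t\<^sub>1 + t\<^sub>2 - (1 + c))/(t\<^sub>1 t\<^sub>2)\<close>.\<close>

lemma good_weights_chord:
  assumes n: "3 \<le> n" and w: "\<omega>\<^sub>1 ^ n = 1" "\<omega>\<^sub>2 ^ n = 1" "Re \<omega>\<^sub>1 < 1"
    and c: "c = real n / (2 * real (n - 1))"
    and between: "- c \<le> Re \<omega>\<^sub>1" "Re \<omega>\<^sub>2 < - c"
    and chord: "10 * (1 - Re \<omega>\<^sub>1 - Re \<omega>\<^sub>2 - c) \<le> 7 * ((1 - Re \<omega>\<^sub>1) * (1 - Re \<omega>\<^sub>2))"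
  shows "\<exists>\<mu> \<nu>. good_weights n \<omega>\<^sub>1 \<omega>\<^sub>2 \<mu> \<nu>"
proof -
  define t1 t2 where "t1 = 1 - Re \<omega>\<^sub>1" and "t2 = 1 - Re \<omega>\<^sub>2"
  define d where "d = t2 - t1"
  have c0: "0 < c" using n by (simp add: c)
  have t: "t1 > 0" "t2 > 0" "d > 0" using w between c0 by (simp_all add: t1_def t2_def d_def)
  define \<mu> \<nu> where "\<mu> = (t2 - (1 + c)) / d" and "\<nu> = ((1 + c) - t1) / d"
  have sum: "\<mu> + \<nu> = 1" using t by (simp add: \<mu>_def \<nu>_def add_divide_distrib[symmetric] d_def)
  have mean: "\<mu> * t1 + \<nu> * t2 = 1 + c"
  proof -
    have "\<mu> * t1 + \<nu> * t2 = ((t2 - (1 + c)) * t1 + ((1 + c) - t1) * t2) / d"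
      by (simp add: \<mu>_def \<nu>_def add_divide_distrib)
    also have "(t2 - (1 + c)) * t1 + ((1 + c) - t1) * t2 = (1 + c) * d" by (simp add: d_def algebra_simps)
    finally show ?thesis using t by simp
  qed
  have "\<mu> / t1 + \<nu> / t2 = (\<mu> * t2 + \<nu> * t1) / (t1 * t2)" using t by (simp add: field_simps)
  also have "\<mu> * t2 + \<nu> * t1 = t1 + t2 - (1 + c)"
  proof -
    have "(\<mu> + \<nu>) * (t1 + t2) = (\<mu> * t1 + \<nu> * t2) + (\<mu> * t2 + \<nu> * t1)" by (simp add: algebra_simps)
    then show ?thesis using sum mean by simp
  qed
  also have "(t1 + t2 - (1 + c)) / (t1 * t2) \<le> 7 / 10"
  proof -
    have "10 * (t1 + t2 - (1 + c)) \<le> 7 * (t1 * t2)" using chord by (simp add: t1_def t2_def)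
    then show ?thesis using t by (simp add: pos_divide_le_eq)
  qed
  finally have val: "\<mu> / t1 + \<nu> / t2 \<le> 7 / 10" .
  have "\<mu> * (1 + Re \<omega>\<^sub>1) + \<nu> * (1 + Re \<omega>\<^sub>2) = 2 * (\<mu> + \<nu>) - (\<mu> * t1 + \<nu> * t2)"
    by (simp add: t1_def t2_def algebra_simps)
  also have "\<dots> = 1 - c" using sum mean by simp
  also have "\<dots> = real (n - 2) / (2 * real (n - 1))"
    using n by (simp add: c field_simps of_nat_diff)
  finally have "good_weights n \<omega>\<^sub>1 \<omega>\<^sub>2 \<mu> \<nu>"
    using w between c0 t sum val unfolding good_weights_def t1_def[symmetric] t2_def[symmetric]
    by (auto simp: \<mu>_def \<nu>_def t1_def t2_def)
  then show ?thesis by blast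
qed

lemma good_weights_exist_3: "\<exists>\<omega>\<^sub>1 \<omega>\<^sub>2 \<mu> \<nu>. good_weights 3 \<omega>\<^sub>1 \<omega>\<^sub>2 \<mu> \<nu>"
proof -
  have "cis (2 * pi / 3) ^ 3 = 1" using cis_root_of_unity[of 3 1] by simp
  moreover have "Re (cis (2 * pi / 3)) = - 1 / 2" by (simp add: cos_120)
  ultimately have "good_weights 3 (cis (2 * pi / 3)) (cis (2 * pi / 3)) 1 0"
    unfolding good_weights_def by simp
  then show ?thesis by blast
qed

lemma good_weights_exist_4: "\<exists>\<omega>\<^sub>1 \<omega>\<^sub>2 \<mu> \<nu>. good_weights 4 \<omega>\<^sub>1 \<omega>\<^sub>2 \<mu> \<nu>"
proof -
  have "\<exists>\<mu> \<nu>. good_weights 4 \<i> (- 1) \<mu> \<nu>"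
    by (rule good_weights_chord[OF _ _ _ _ refl]) simp_all
  then show ?thesis by blast
qed

text \<open>The real parts are the two roots of \<open>4 x^2 + 2 x - 1\<close>, and the chord condition is an equality.\<close>

lemma good_weights_exist_5: "\<exists>\<omega>\<^sub>1 \<omega>\<^sub>2 \<mu> \<nu>. good_weights 5 \<omega>\<^sub>1 \<omega>\<^sub>2 \<mu> \<nu>"
proof -
  define w where "w = cis (2 * pi / 5)"
  define g where "g = Re w"
  have w5: "w ^ 5 = 1" using cis_root_of_unity[of 5 1] by (simp add: w_def)
  have nw: "(Re w)\<^sup>2 + (Im w)\<^sup>2 = 1" by (simp add: w_def)
  have g0: "0 < g" unfolding g_def w_def cis.sel by (rule cos_gt_zero) (simp_all add: field_simps)
  have "g < cos 0" unfolding g_def w_def cis.sel by (rule cos_monotone_0_pi) (simp_all add: field_simps)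
  then have g1: "g < 1" by simp
  have w2: "Re (w ^ 2) = 2 * g\<^sup>2 - 1" using nw by (simp add: power2_eq_square g_def)
  have quad: "4 * g\<^sup>2 + 2 * g = 1"
  proof -
    have "w ^ 4 = cnj w" using root_of_unity_power_diff[OF w5, of 1] by simp
    moreover have "w ^ 3 = cnj (w ^ 2)" using root_of_unity_power_diff[OF w5, of 2] by simp
    moreover have "(w - 1) * (1 + w + w ^ 2 + w ^ 3 + w ^ 4) = w ^ 5 - 1"
      by (simp add: algebra_simps power_eq_if numeral_eq_Suc)
    moreover have "w \<noteq> 1" using g1 by (auto simp: g_def)
    ultimately have "1 + w + w ^ 2 + cnj (w ^ 2) + cnj w = 0" using w5 by simp
    moreover have "1 + 2 * Re a + 2 * Re b = 0" if "1 + a + b + cnj b + cnj a = 0" for a b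
      using that by (simp add: complex_eq_iff)
    ultimately have "1 + 2 * Re w + 2 * Re (w ^ 2) = 0" by blast
    then show ?thesis unfolding w2 by (simp add: g_def[symmetric])
  qed
  have "1 / 8 < g"
  proof (rule ccontr)
    assume "\<not> 1 / 8 < g"
    then have "g * g \<le> 1 / 8 * (1 / 8)" using g0 by (intro mult_mono) auto
    then show False using quad \<open>\<not> 1 / 8 < g\<close> by (simp add: power2_eq_square)
  qed
  then have "\<exists>\<mu> \<nu>. good_weights 5 w (w ^ 2) \<mu> \<nu>"
  proof (intro good_weights_chord[OF _ w5 _ _ refl])
    show "(w ^ 2) ^ 5 = 1" by (metis power_mult mult.commute power_one w5)
    have w2': "Re (w ^ 2) = - 1 / 2 - g" unfolding w2 using quad by simp
    show "10 * (1 - Re w - Re (w ^ 2) - real 5 / (2 * real (5 - 1))) \<le> 7 * ((1 - Re w) * (1 - Re (w ^ 2)))"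
    proof -
      have "(1 - g) * (1 - (- 1 / 2 - g)) = 3 / 2 - g / 2 - g\<^sup>2" by algebra
      then have "(1 - g) * (1 - (- 1 / 2 - g)) = 5 / 4" using quad by argo
      then show ?thesis unfolding w2' g_def[symmetric] by simp
    qed
    assume "1 / 8 < g"
    then show "Re (w ^ 2) < - (real 5 / (2 * real (5 - 1)))" by (simp add: w2')
  qed (use g0 g1 in \<open>simp_all add: g_def\<close>)
  then show ?thesis by blast
qed

text \<open>At \<open>n = 5\<close> the inequality just fails, which is why smaller degrees are treated separately.\<close>

lemma cos_square_bound:
  assumes "6 \<le> n"
  shows "7 / 8 * (real (n - 2) / real (n - 1)) \<le> (cos (pi / real n))\<^sup>2"
proof -
  have "(sin (pi / real n))\<^sup>2 \<le> (pi / real n)\<^sup>2"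
    using abs_sin_x_le_abs_x[of "pi / real n"] by (simp only: abs_le_square_iff)
  also have "\<dots> \<le> 10 / (real n)\<^sup>2"
  proof -
    \<comment> \<open>The estimate has room for \<open>\<pi>^2 \<le> 10\<close>.\<close>
    have "pi\<^sup>2 \<le> (315 / 100)\<^sup>2" using pi_approx by (intro power_mono) auto
    also have "\<dots> \<le> 10" by (simp add: power2_eq_square)
    finally show ?thesis by (simp add: power_divide divide_right_mono)
  qed
  also have "\<dots> \<le> 1 - 7 / 8 * (real (n - 2) / real (n - 1))"
  proof -
    have N: "real n \<ge> 6" "real (n - 1) = real n - 1" "real (n - 2) = real n - 2" using assms by auto
    \<comment> \<open>The cubic \<open>x^3 + 6 x^2\<close> lies above its tangent line at 6.\<close>
    have cubic: "80 * (x - 1) \<le> x\<^sup>2 * (x + 6)" if "x \<ge> 6" for x :: real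
    proof -
      have "0 \<le> (x - 6)\<^sup>2 * (x + 18)" using that by simp
      moreover have "(x - 6)\<^sup>2 * (x + 18) = x\<^sup>2 * (x + 6) - 180 * x + 648" by (simp add: power2_eq_square algebra_simps)
      ultimately show ?thesis using that by simp
    qed
    have "1 - 7 / 8 * (real (n - 2) / real (n - 1)) = (real n + 6) / (8 * (real n - 1))"
      unfolding N using N(1) by (simp add: field_simps)
    moreover have "10 / (real n)\<^sup>2 \<le> (real n + 6) / (8 * (real n - 1))"
      using cubic[OF N(1)] N(1) by (simp add: divide_le_eq le_divide_eq field_simps)
    ultimately show ?thesis by simp
  qed
  finally show ?thesis by (simp add: cos_squared_eq)
qed

text \<open>Neighbouring roots of unity at angles \<open>m - h\<close> and \<open>m + h\<close> on either side of \<open>-c\<close> are used. With \<open>x = cos m\<close> and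
  \<open>g = cos h\<close> the chord condition becomes \<open>7 x^2 + 6 x g + 7 g^2 \<ge> 10 (1 - c)\<close>, whose left side is at least
  \<open>40 g^2/7\<close> for every \<open>x\<close>; so the position of the pair does not matter, and only its half-gap \<open>h = \<pi>/n\<close> does.\<close>

lemma good_weights_exist_ge_6:
  assumes n: "6 \<le> n"
  shows "\<exists>\<omega>\<^sub>1 \<omega>\<^sub>2 \<mu> \<nu>. good_weights n \<omega>\<^sub>1 \<omega>\<^sub>2 \<mu> \<nu>"
proof -
  define c where "c = real n / (2 * real (n - 1))"
  define h where "h = pi / real n"
  let ?\<theta> = "\<lambda>k. 2 * pi * real k / real n"
  have c: "c \<le> 3 / 5" using n by (simp add: c_def field_simps of_nat_diff)
  have cos2: "7 / 8 * (real (n - 2) / real (n - 1)) \<le> (cos h)\<^sup>2"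
    using cos_square_bound[OF n] by (simp add: h_def)
  have h: "0 < h" "h < pi / 2" using n by (simp_all add: h_def field_simps)
  have cosh: "c < cos h"
  proof -
    have "4 / 5 \<le> real (n - 2) / real (n - 1)" using n by (simp add: field_simps of_nat_diff)
    then have "(3 / 5)\<^sup>2 < (cos h)\<^sup>2" using cos2 by (simp add: power2_eq_square)
    moreover have "0 < cos h" by (rule cos_gt_zero) (use h in auto)
    ultimately have "3 / 5 < cos h" by (intro power_less_imp_less_base[of "3/5" 2]) auto
    with c show ?thesis by simp
  qed
  \<comment> \<open>The root of unity closest to -1 has angle \<open>\<pi>\<close> or \<open>\<pi> - h\<close>, according to the parity of \<open>n\<close>.\<close>
  have end_point: "cos (?\<theta> (n div 2)) < - c"
  proof (cases "even n")
    case True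
    then have "?\<theta> (n div 2) = pi" using n by (simp add: real_of_nat_div field_simps)
    moreover have "c < 1" using c by simp
    ultimately show ?thesis by simp
  next
    case False
    then have "real n = 2 * real (n div 2) + 1" by (metis odd_two_times_div_two_succ of_nat_1 of_nat_add of_nat_mult of_nat_numeral)
    then have "?\<theta> (n div 2) = pi - h" using n by (simp add: h_def field_simps)
    then show ?thesis using cosh by simp
  qed
  have start: "- c \<le> cos (?\<theta> 1)"
  proof -
    have "0 < cos (?\<theta> 1)" by (rule cos_gt_zero) (use n in \<open>auto simp: field_simps\<close>)
    moreover have "0 \<le> c" by (simp add: c_def)
    ultimately show ?thesis by linarith
  qed
  define K where "K = (LEAST k. 1 \<le> k \<and> cos (?\<theta> k) < - c)"
  have n2: "1 \<le> n div 2" using n by simp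
  have K: "1 \<le> K" "cos (?\<theta> K) < - c" "K \<le> n div 2"
    unfolding K_def using LeastI[of "\<lambda>k. 1 \<le> k \<and> cos (?\<theta> k) < - c" "n div 2"]
      Least_le[of "\<lambda>k. 1 \<le> k \<and> cos (?\<theta> k) < - c" "n div 2"] end_point n2 by auto
  \<comment> \<open>The first index past the threshold and its predecessor bracket \<open>-c\<close>.\<close>
  have "K \<noteq> 1" using K(2) start by (metis not_less)
  then obtain k where k: "K = Suc k" "1 \<le> k" using K(1) by (cases K) auto
  have ck: "- c \<le> cos (?\<theta> k)"
    using not_less_Least[of k "\<lambda>k. 1 \<le> k \<and> cos (?\<theta> k) < - c"] k unfolding K_def by auto
  have "cos (?\<theta> k) < cos 0"
  proof (rule cos_monotone_0_pi)
    have "2 * real k \<le> real n" using K(3) k by linarith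
    then show "?\<theta> k \<le> pi" using n by (simp add: field_simps)
  qed (use k n in auto)
  then have ck1: "cos (?\<theta> k) < 1" by simp
  define m where "m = ?\<theta> k + h"
  have th: "?\<theta> k = m - h" "?\<theta> (Suc k) = m + h"
    using n by (simp_all add: m_def h_def field_simps)
  define x g where "x = cos m" and "g = cos h"
  have sum: "cos (m - h) + cos (m + h) = 2 * x * g" by (simp add: x_def g_def cos_add cos_diff)
  have prod: "cos (m - h) * cos (m + h) = x\<^sup>2 + g\<^sup>2 - 1"
  proof -
    have "cos (m - h) * cos (m + h) = x\<^sup>2 * g\<^sup>2 - (sin m)\<^sup>2 * (sin h)\<^sup>2"
      by (simp add: x_def g_def cos_add cos_diff power2_eq_square algebra_simps)
    then show ?thesis by (simp add: sin_squared_eq x_def g_def algebra_simps)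
  qed
  have "10 * (1 - c) \<le> 40 / 7 * g\<^sup>2"
  proof -
    have "10 * (1 - c) = 5 * (real (n - 2) / real (n - 1))"
      using n by (simp add: c_def field_simps of_nat_diff)
    then show ?thesis using cos2 by (simp add: g_def)
  qed
  moreover have "7 * x\<^sup>2 + 6 * x * g + 7 * g\<^sup>2 = 7 * (x + 3 / 7 * g)\<^sup>2 + 40 / 7 * g\<^sup>2"
    by (simp add: power2_eq_square algebra_simps)
  moreover have "0 \<le> (x + 3 / 7 * g)\<^sup>2" by simp
  ultimately have key: "10 * (1 - c) \<le> 7 * x\<^sup>2 + 6 * x * g + 7 * g\<^sup>2" by linarith
  have "\<exists>\<mu> \<nu>. good_weights n (cis (?\<theta> k)) (cis (?\<theta> (Suc k))) \<mu> \<nu>"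
  proof (rule good_weights_chord[OF _ _ _ _ c_def])
    have "(1 - cos (m - h)) * (1 - cos (m + h)) = 1 - (cos (m - h) + cos (m + h)) + cos (m - h) * cos (m + h)"
      by (simp add: algebra_simps)
    then have p: "(1 - cos (m - h)) * (1 - cos (m + h)) = x\<^sup>2 + g\<^sup>2 - 2 * x * g"
      unfolding sum prod by simp
    have "1 - cos (m - h) - cos (m + h) - c = 1 - 2 * x * g - c" using sum by linarith
    then show "10 * (1 - Re (cis (?\<theta> k)) - Re (cis (?\<theta> (Suc k))) - c)
        \<le> 7 * ((1 - Re (cis (?\<theta> k))) * (1 - Re (cis (?\<theta> (Suc k)))))"
      unfolding cis.sel th p using key by argo
  qed (use n ck ck1 K k in \<open>auto intro!: cis_root_of_unity simp del: of_nat_Suc\<close>)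
  then show ?thesis by blast
qed

lemma good_weights_exist:
  assumes "3 \<le> n"
  shows "\<exists>\<omega>\<^sub>1 \<omega>\<^sub>2 \<mu> \<nu>. good_weights n \<omega>\<^sub>1 \<omega>\<^sub>2 \<mu> \<nu>"
proof -
  consider "n = 3" | "n = 4" | "n = 5" | "6 \<le> n" using assms by linarith
  then show ?thesis
    by cases (auto intro: good_weights_exist_3 good_weights_exist_4 good_weights_exist_5 good_weights_exist_ge_6)
qed

section \<open>The bound for the Sendov radius\<close>

text \<open>The filter lives on all admissible triples, so an eventual bound along it has constants that depend on \<open>n\<close> only. A
  lower bound for the defect, a sum over the \<open>n - 1\<close> critical points, yields one critical point with
  \<open>1 - \<bar>\<beta> - \<zeta>\<^sub>j\<bar>^2\<close> at least the average.\<close>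

lemma uniform_critical_point_bound:
  assumes n: "3 \<le> n"
  shows "\<exists>K b. b < 1 \<and> (\<forall>\<beta> z \<zeta>. b < \<beta> \<and> \<beta> < 1 \<and> config n \<beta> z \<zeta> \<and>
      (\<forall>j<n-1. \<beta> \<le> norm (of_real \<beta> - \<zeta> j)) \<longrightarrow>
      (\<exists>j<n-1. norm (of_real \<beta> - \<zeta> j) \<le> 1 - 3 / 10 * (1 - \<beta>) + K * (1 - \<beta>)\<^sup>2))"
proof -
  define A where "A = {x :: real \<times> (nat \<Rightarrow> complex) \<times> (nat \<Rightarrow> complex).
    config n (fst x) (fst (snd x)) (snd (snd x)) \<and>
    (\<forall>j<n-1. fst x \<le> norm (of_real (fst x) - snd (snd x) j))}"
  define F where "F = inf (filtercomap fst (at_left (1::real))) (principal A)"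
  interpret far_critical_family F n fst "\<lambda>k x. fst (snd x) k" "\<lambda>j x. snd (snd x) j"
  proof
    show "filterlim fst (at_left 1) F"
      unfolding F_def by (rule filterlim_mono[OF filterlim_filtercomap order.refl inf_le1])
    have "\<forall>\<^sub>F x in F. x \<in> A" unfolding F_def by (simp add: eventually_inf_principal)
    then show "\<forall>\<^sub>F x in F. config n (fst x) (\<lambda>k. fst (snd x) k) (\<lambda>j. snd (snd x) j)"
      and "\<forall>\<^sub>F x in F. \<forall>j<n-1. fst x \<le> norm (of_real (fst x) - snd (snd x) j)"
      by (auto simp: A_def elim!: eventually_mono)
  qed (rule n)
  obtain \<omega>\<^sub>1 \<omega>\<^sub>2 \<mu> \<nu> where "good_weights n \<omega>\<^sub>1 \<omega>\<^sub>2 \<mu> \<nu>" using good_weights_exist[OF n] by blast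
  then have "le_order 4 (\<lambda>x. 3 / 10 * (s x)\<^sup>2 - defect x / (2 * real (n - 1)))"
    unfolding good_weights_def by (intro defect_lower_bound[of \<omega>\<^sub>1 \<omega>\<^sub>2 \<mu> \<nu>]) auto
  then obtain K where "\<forall>\<^sub>F x in F. 3 / 10 * (s x)\<^sup>2 - defect x / (2 * real (n - 1)) \<le> K * s x ^ 4"
    by (auto simp: le_order_def)
  then have "\<forall>\<^sub>F x in F. 3 / 10 * (1 - fst x) - K * (1 - fst x)\<^sup>2 \<le> defect x / (2 * real (n - 1))"
    using s_square
  proof eventually_elim
    case (elim x)
    have "s x ^ 4 = ((s x)\<^sup>2)\<^sup>2" by (simp flip: power_mult)
    with elim show ?case by simp
  qed
  then obtain b where b: "b < 1" and bound: "\<And>x. b < fst x \<Longrightarrow> fst x < 1 \<Longrightarrow> x \<in> A \<Longrightarrow>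
      3 / 10 * (1 - fst x) - K * (1 - fst x)\<^sup>2 \<le> defect x / (2 * real (n - 1))"
    unfolding F_def eventually_inf_principal eventually_filtercomap
    by (auto simp: eventually_at_left[of 0 1, OF zero_less_one])
  have "\<exists>j<n-1. norm (of_real \<beta> - \<zeta> j) \<le> 1 - 3 / 10 * (1 - \<beta>) + K * (1 - \<beta>)\<^sup>2"
    if "b < \<beta>" "\<beta> < 1" "config n \<beta> z \<zeta>" "\<forall>j<n-1. \<beta> \<le> norm (of_real \<beta> - \<zeta> j)" for \<beta> z \<zeta>
  proof (rule ccontr)
    define y where "y = 3 / 10 * (1 - \<beta>) - K * (1 - \<beta>)\<^sup>2"
    assume "\<not> ?thesis"
    then have large: "1 - y < norm (of_real \<beta> - \<zeta> j)" if "j < n - 1" for j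
      using that by (auto simp: y_def not_le algebra_simps)
    have "1 - (norm (of_real \<beta> - \<zeta> j))\<^sup>2 < 2 * y" if "j < n - 1" for j
    proof -
      \<comment> \<open>This replaces taking a square root: \<open>r \<le> (1 + r^2)/2\<close>.\<close>
      have "2 * norm (of_real \<beta> - \<zeta> j) \<le> 1 + (norm (of_real \<beta> - \<zeta> j))\<^sup>2"
        using zero_le_power2[of "norm (of_real \<beta> - \<zeta> j) - 1"] by (simp add: power2_eq_square algebra_simps)
      with large[OF that] show ?thesis by linarith
    qed
    then have "defect (\<beta>, z, \<zeta>) < (\<Sum>j<n-1. 2 * y)"
      unfolding defect_def using n by (intro sum_strict_mono) (auto simp: lessThan_empty_iff)
    moreover have "y \<le> defect (\<beta>, z, \<zeta>) / (2 * real (n - 1))"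
      using bound[of "(\<beta>, z, \<zeta>)"] that by (simp add: A_def y_def)
    ultimately show False using n by (simp add: field_simps)
  qed
  with b show ?thesis by blast
qed

lemma S_set_config:
  assumes P: "P \<in> S_set n \<beta>" and n: "2 \<le> n"
  shows "\<exists>z \<zeta>. config n \<beta> z \<zeta> \<and> (\<forall>j<n-1. crit_dist P \<beta> \<le> norm (of_real \<beta> - \<zeta> j))"
proof -
  have deg: "degree P = n" and roots: "\<And>w. poly P w = 0 \<Longrightarrow> norm w \<le> 1"
    and "poly P (of_real \<beta>) = 0" using P by (auto simp: S_set_def)
  then obtain Q where Q: "P = [:- of_real \<beta>, 1:] * Q" by (auto simp: poly_eq_0_iff_dvd dvd_def)
  have "P \<noteq> 0" using deg n by auto
  then have Q0: "Q \<noteq> 0" using Q by auto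
  have "degree P = 1 + degree Q" unfolding Q using Q0 by (subst degree_mult_eq) auto
  then have degQ: "degree Q = n - 1" using deg by simp
  obtain z where z: "smult (lead_coeff Q) (root_poly (n - 1) z) = Q"
    using complex_poly_decompose'[of Q] unfolding degQ root_poly_def[symmetric] by blast
  define R where "R = [:- of_real \<beta>, 1:] * root_poly (n - 1) z"
  have PR: "P = smult (lead_coeff Q) R" by (metis Q R_def mult_smult_right z)
  have lcQ: "lead_coeff Q \<noteq> 0" using Q0 by simp
  have "norm (z k) \<le> 1" if "k < n - 1" for k
  proof (rule roots)
    have "poly (root_poly (n - 1) z) (z k) = 0" using that by (auto simp: poly_root_poly)
    then show "poly P (z k) = 0" by (simp add: PR R_def)
  qed
  moreover obtain \<zeta> where \<zeta>: "pderiv R = smult (of_nat n) (root_poly (n - 1) \<zeta>)"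
  proof -
    have degR: "degree R = n" using deg PR lcQ by simp
    then have "degree (pderiv R) = n - 1" by (simp add: degree_pderiv)
    moreover have "lead_coeff R = 1"
      unfolding R_def lead_coeff_mult by (simp add: lead_coeff_root_poly del: mult_pCons_left)
    then have "coeff (pderiv R) (n - 1) = of_nat n" using degR n by (simp add: coeff_pderiv)
    ultimately show ?thesis
      using complex_poly_decompose'[of "pderiv R"] that unfolding root_poly_def[symmetric] by metis
  qed
  ultimately have "config n \<beta> z \<zeta>" by (simp add: config_def R_def)
  moreover have "crit_dist P \<beta> \<le> norm (of_real \<beta> - \<zeta> j)" if "j < n - 1" for j
  proof -
    have "pderiv P \<noteq> 0" using deg n by (simp add: pderiv_eq_0_iff)
    then have "finite {\<zeta>. poly (pderiv P) \<zeta> = 0}" by (rule poly_roots_finite)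
    then have "finite {dist (of_real \<beta>) \<zeta> | \<zeta>. poly (pderiv P) \<zeta> = 0}" by simp
    moreover have "poly (pderiv P) (\<zeta> j) = 0"
      using that by (auto simp: PR pderiv_smult \<zeta> poly_root_poly)
    ultimately show ?thesis
      unfolding crit_dist_def by (intro Min_le) (auto simp: dist_norm)
  qed
  ultimately show ?thesis by blast
qed

text \<open>In degree 2 the critical point is the midpoint of the two roots. This degree is separate because the square roots of
  unity are real.\<close>

lemma quadratic_critical_point:
  assumes "config 2 \<beta> z \<zeta>" "0 \<le> \<beta>"
  shows "norm (of_real \<beta> - \<zeta> 0) \<le> 1 - (1 - \<beta>) / 2"
proof -
  have "of_real \<beta> - z 0 = 2 * (of_real \<beta> - \<zeta> 0)"
    using config_prod[OF assms(1)] by simp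
  then have "norm (of_real \<beta> - z 0) = 2 * norm (of_real \<beta> - \<zeta> 0)"
    by (simp only: norm_mult norm_numeral)
  moreover have "norm (of_real \<beta> - z 0) \<le> \<beta> + 1"
    using norm_triangle_ineq4[of "of_real \<beta>" "z 0"] assms by (simp add: config_def)
  ultimately show ?thesis by argo
qed

lemma r_sup_le:
  assumes "0 < n" "0 \<le> \<beta>" "\<beta> \<le> 1" and bound: "\<And>P. P \<in> S_set n \<beta> \<Longrightarrow> crit_dist P \<beta> \<le> B"
  shows "r_sup n \<beta> \<le> B"
  unfolding r_sup_def
proof (rule cSUP_least[OF _ bound])
  have "[:- of_real \<beta>, 1:] ^ n \<in> S_set n \<beta>"
    using assms by (auto simp: S_set_def degree_power_eq poly_power)
  then show "S_set n \<beta> \<noteq> {}" by blast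
qed

theorem corollary2:
  fixes n :: nat
  assumes "n \<ge> 2"
  shows "\<exists>C \<beta>\<^sub>0 :: real. 0 \<le> \<beta>\<^sub>0 \<and> \<beta>\<^sub>0 < 1 \<and>
    (\<forall>\<beta>\<in>{\<beta>\<^sub>0<..<1}. r_sup n \<beta> \<le> 1 - 3 / 10 * (1 - \<beta>) + C * (1 - \<beta>)^2)"
proof -
  have "\<exists>K b. b < 1 \<and> (\<forall>\<beta> z \<zeta>. b < \<beta> \<and> 0 < \<beta> \<and> \<beta> < 1 \<and> config n \<beta> z \<zeta> \<longrightarrow>
      (\<exists>j<n-1. norm (of_real \<beta> - \<zeta> j) \<le> 1 - 3 / 10 * (1 - \<beta>) + K * (1 - \<beta>)\<^sup>2))"
  proof (cases "n = 2")
    case True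
    show ?thesis
    proof (intro exI[of _ "0 :: real"] conjI allI impI)
      fix \<beta> z \<zeta> assume "0 < \<beta> \<and> 0 < \<beta> \<and> \<beta> < 1 \<and> config n \<beta> z \<zeta>"
      then have "norm (of_real \<beta> - \<zeta> 0) \<le> 1 - (1 - \<beta>) / 2" "0 < n - 1" "\<beta> < 1"
        using quadratic_critical_point[of \<beta> z \<zeta>] True by auto
      moreover from this have "norm (of_real \<beta> - \<zeta> 0) \<le> 1 - 3 / 10 * (1 - \<beta>) + 0 * (1 - \<beta>)\<^sup>2"
        by argo
      ultimately show "\<exists>j<n-1. norm (of_real \<beta> - \<zeta> j) \<le> 1 - 3 / 10 * (1 - \<beta>) + 0 * (1 - \<beta>)\<^sup>2"
        by blast
    qed simp
  next
    case False
    then obtain K b where b: "b < 1" and K: "\<And>\<beta> z \<zeta>. b < \<beta> \<Longrightarrow> \<beta> < 1 \<Longrightarrow> config n \<beta> z \<zeta> \<Longrightarrow>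
      \<forall>j<n-1. \<beta> \<le> norm (of_real \<beta> - \<zeta> j) \<Longrightarrow>
      \<exists>j<n-1. norm (of_real \<beta> - \<zeta> j) \<le> 1 - 3 / 10 * (1 - \<beta>) + K * (1 - \<beta>)\<^sup>2"
    proof -
      have "3 \<le> n" using False assms by simp
      from uniform_critical_point_bound[OF this] show ?thesis using that by blast
    qed
    \<comment> \<open>A critical point closer than \<open>\<beta>\<close> settles the matter at once, provided that the constant is nonnegative.\<close>
    have "\<exists>j<n-1. norm (of_real \<beta> - \<zeta> j) \<le> 1 - 3 / 10 * (1 - \<beta>) + max K 0 * (1 - \<beta>)\<^sup>2"
      if "b < \<beta>" "\<beta> < 1" "config n \<beta> z \<zeta>" for \<beta> z \<zeta>
    proof (cases "\<forall>j<n-1. \<beta> \<le> norm (of_real \<beta> - \<zeta> j)")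
      case True
      have "K * (1 - \<beta>)\<^sup>2 \<le> max K 0 * (1 - \<beta>)\<^sup>2" by (intro mult_right_mono) auto
      with K[OF that True] show ?thesis by fastforce
    next
      case False
      then obtain j where j: "j < n - 1" "norm (of_real \<beta> - \<zeta> j) < \<beta>" by force
      have "0 \<le> max K 0 * (1 - \<beta>)\<^sup>2" by simp
      then have "\<beta> \<le> 1 - 3 / 10 * (1 - \<beta>) + max K 0 * (1 - \<beta>)\<^sup>2" using that by argo
      with j show ?thesis by (intro exI[of _ j]) linarith
    qed
    with b show ?thesis by blast
  qed
  then obtain K b where b: "b < 1" and K: "\<And>\<beta> z \<zeta>. b < \<beta> \<Longrightarrow> 0 < \<beta> \<Longrightarrow> \<beta> < 1 \<Longrightarrow> config n \<beta> z \<zeta> \<Longrightarrow>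
      \<exists>j<n-1. norm (of_real \<beta> - \<zeta> j) \<le> 1 - 3 / 10 * (1 - \<beta>) + K * (1 - \<beta>)\<^sup>2"
    by blast
  show ?thesis
  proof (intro exI conjI ballI)
    fix \<beta> assume "\<beta> \<in> {max b 0<..<1}"
    then have beta: "b < \<beta>" "0 < \<beta>" "\<beta> < 1" by auto
    show "r_sup n \<beta> \<le> 1 - 3 / 10 * (1 - \<beta>) + K * (1 - \<beta>)\<^sup>2"
    proof (rule r_sup_le)
      fix P assume "P \<in> S_set n \<beta>"
      then obtain z \<zeta> where "config n \<beta> z \<zeta>" and d: "\<forall>j<n-1. crit_dist P \<beta> \<le> norm (of_real \<beta> - \<zeta> j)"
        using S_set_config assms by blast
      then obtain j where "j < n - 1" "norm (of_real \<beta> - \<zeta> j) \<le> 1 - 3 / 10 * (1 - \<beta>) + K * (1 - \<beta>)\<^sup>2"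
        using K beta by blast
      with d show "crit_dist P \<beta> \<le> 1 - 3 / 10 * (1 - \<beta>) + K * (1 - \<beta>)\<^sup>2" by force
    qed (use assms beta in auto)
  qed (use b in auto)
qed

end
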